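(* Let $\mathbb{G}$ be a homogeneous group of homogeneous dimension $Q\geq 1$ and let $|\cdot|$ be an arbitrary homogeneous quasi-norm on $\mathbb{G}$. Let $\lambda>0$, $p,q'\in(0,1)$, and let $p',q$ be defined by $\frac1p+\frac1{p'}=1$ and $\frac1q+\frac1{q'}=1$. Let $0\leq\alpha<-\frac{Q}{q}$, $0\leq\beta<-\frac{Q}{p'}$, and suppose $$\frac{1}{q'}+\frac{1}{p}=\frac{\alpha+\beta+\lambda}{Q}+2.$$ Then there is a constant $C>0$, independent of $f$ and $h$, such that for all non-negative functions $f\in L^{q'}(\mathbb{G})$ and $h\in L^{p}(\mathbb{G})$, $$\int_{\mathbb{G}}\int_{\mathbb{G}}|x|^{\alpha}\,|y^{-1}x|^{\lambda}f(x)h(y)\,|y|^{\beta}\,dx\,dy\geq C\,\|f\|_{L^{q'}(\mathbb{G})}\|h\|_{L^{p}(\mathbb{G})}.$$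
   Context: A homogeneous (Lie) group $\mathbb{G}$ is a Lie group on $\mathbb{R}^N$ equipped with dilations $D_\lambda(x)=(\lambda^{\nu_1}x_1,\ldots,\lambda^{\nu_N}x_N)$, $\nu_1,\ldots,\nu_N>0$, such that $D_\lambda$ is an automorphism of the group $\mathbb{G}$ for each $\lambda>0$; one writes $\lambda x$ for $D_\lambda(x)$. Its homogeneous dimension is $Q=\nu_1+\cdots+\nu_N$. A homogeneous quasi-norm on $\mathbb{G}$ is a continuous non-negative function $x\mapsto|x|\in[0,\infty)$ with $|x^{-1}|=|x|$ for all $x$, $|\lambda x|=\lambda|x|$ for all $x\in\mathbb{G}$ and $\lambda>0$, and $|x|=0$ if and only if $x=0$. Here $dx$ is the Haar measure on $\mathbb{G}$ (Lebesgue measure on $\mathbb{R}^N$), $y^{-1}x$ is the group product, and for $0<s<1$, $\|f\|_{L^s(\mathbb{G})}=\left(\int_{\mathbb{G}}|f(x)|^s dx\right)^{1/s}$. Note that $q<0$ and $p'<0$. *)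

theory Defs
  imports "HOL-Analysis.Analysis" "HOL-Algebra.Group"
begin

text \<open>
  \<open>Ck k f\<close> says that \<open>f\<close> is of class \<open>C\<^sup>k\<close> on the whole space: \<open>f\<close> is differentiable and each of its
  directional derivatives is of class \<open>C\<^sup>k\<^sup>-\<^sup>1\<close>. On finite-dimensional spaces this is the usual notion.
\<close>
primrec Ck :: "nat \<Rightarrow> ('a::euclidean_space \<Rightarrow> 'b::euclidean_space) \<Rightarrow> bool" where
  "Ck 0 f \<longleftrightarrow> continuous_on UNIV f"
| "Ck (Suc k) f \<longleftrightarrow>
     (\<forall>x. f differentiable (at x)) \<and> (\<forall>v. Ck k (\<lambda>x. frechet_derivative f (at x) v))"

definition smooth :: "('a::euclidean_space \<Rightarrow> 'b::euclidean_space) \<Rightarrow> bool" where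
  "smooth f \<longleftrightarrow> (\<forall>k. Ck k f)"

definition dilation :: "('n::finite \<Rightarrow> real) \<Rightarrow> real \<Rightarrow> real ^ 'n \<Rightarrow> real ^ 'n" where
  "dilation \<nu> r x = (\<chi> i. r powr \<nu> i * x $ i)"

definition hom_dim :: "('n::finite \<Rightarrow> real) \<Rightarrow> real" where
  "hom_dim \<nu> = (\<Sum>i\<in>UNIV. \<nu> i)"

text \<open>
  The neutral element is not prescribed: it is fixed by all dilations, hence it is \<open>0\<close>.
\<close>
locale homogeneous_group = group G
  for G :: "(real ^ 'n::finite) monoid" (structure) and \<nu> :: "'n \<Rightarrow> real" +
  assumes carrier_UNIV: "carrier G = UNIV"
    and smooth_mult: "smooth (\<lambda>(x, y). x \<otimes> y)"
    and smooth_inv: "smooth (\<lambda>x. inv x)"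
    and weights_pos: "\<And>i. \<nu> i > 0"
    and dilation_automorphism: "\<And>r. r > 0 \<Longrightarrow> dilation \<nu> r \<in> iso G G"

definition homogeneous_quasi_norm ::
    "(real ^ 'n::finite) monoid \<Rightarrow> ('n \<Rightarrow> real) \<Rightarrow> (real ^ 'n \<Rightarrow> real) \<Rightarrow> bool" where
  "homogeneous_quasi_norm G \<nu> N \<longleftrightarrow>
     continuous_on UNIV N \<and>
     (\<forall>x. N x \<ge> 0) \<and>
     (\<forall>x. N (inv\<^bsub>G\<^esub> x) = N x) \<and>
     (\<forall>r>0. \<forall>x. N (dilation \<nu> r x) = r * N x) \<and>
     (\<forall>x. N x = 0 \<longleftrightarrow> x = 0)"

text \<open>
  Lebesgue measure on \<open>\<real>\<^sup>N\<close> is a Haar measure of every homogeneous group on \<open>\<real>\<^sup>N\<close>, so the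
  Lebesgue spaces over the group are those of \<open>lebesgue\<close>. For \<open>0 < s < 1\<close> the functional
  \<open>Ls_norm s\<close> is only a quasi-norm.
\<close>
definition in_Ls :: "real \<Rightarrow> (real ^ 'n::finite \<Rightarrow> real) \<Rightarrow> bool" where
  "in_Ls s f \<longleftrightarrow>
     f \<in> borel_measurable lebesgue \<and> integrable lebesgue (\<lambda>x. \<bar>f x\<bar> powr s)"

definition Ls_norm :: "real \<Rightarrow> (real ^ 'n::finite \<Rightarrow> real) \<Rightarrow> real" where
  "Ls_norm s f = (\<integral>x. \<bar>f x\<bar> powr s \<partial>lebesgue) powr (1 / s)"

end

theory Submission
  imports Defs
begin

text \<open>
  Let \<open>A = Q (1/q' - 1) - \<alpha>\<close> and \<open>B = Q (1/p - 1) - \<beta>\<close>, so \<open>A, B > 0\<close> and \<open>A + B = \<lambda>\<close>. For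
  every \<open>y\<close> and every \<open>\<rho> > 0\<close>, a reverse Hoelder argument with the weight
  \<open>w x = |x|\<^sup>\<alpha> (\<rho>\<^sup>A + \<rho>\<^sup>-\<^sup>B |y\<^sup>-\<^sup>1 x|\<^sup>\<lambda>)\<close> gives
  \<open>\<parallel>f\<parallel> \<le> C (\<rho>\<^sup>A \<integral> |x|\<^sup>\<alpha> f + \<rho>\<^sup>-\<^sup>B \<integral> |x|\<^sup>\<alpha> |y\<^sup>-\<^sup>1 x|\<^sup>\<lambda> f)\<close>
  with \<open>C\<close> independent of \<open>y\<close> and \<open>\<rho>\<close>. Integrating against \<open>|y|\<^sup>\<beta> h y\<close> yields
  \<open>\<parallel>f\<parallel> V \<le> C (\<rho>\<^sup>A U V + \<rho>\<^sup>-\<^sup>B I)\<close>, where \<open>U\<close> and \<open>V\<close> are the weighted masses of \<open>f\<close> and \<open>h\<close> and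
  \<open>I\<close> is the double integral; symmetrically \<open>\<parallel>h\<parallel> U \<le> C (\<rho>\<^sup>B U V + \<rho>\<^sup>-\<^sup>A I)\<close>. Choosing
  \<open>\<rho>\<^sup>\<lambda> = I / (U V)\<close> and multiplying gives \<open>\<parallel>f\<parallel> \<parallel>h\<parallel> \<le> 4 C\<^sup>2 I\<close>. Truncating
  \<open>f\<close> and \<open>h\<close> makes \<open>U\<close> and \<open>V\<close> finite.
\<close>

section \<open>Dyadic shells and a weighted reverse Hoelder inequality\<close>

text \<open>A case rule in which \<open>j\<close> is the floor of the absolute value of log_2
  \<open>x\<close>. The split at 1 matches the change of exponent in
  \<open>nn_integral_power_cutoff_le\<close>.\<close>

lemma dyadic_shell:
  fixes x :: real
  assumes "0 < x"
  obtains j :: nat where "x \<le> 1" "x \<le> 2 powr (- real j)" "2 powr (- (real j + 1)) < x"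
  | j :: nat where "1 < x" "2 powr real j \<le> x" "x \<le> 2 powr (real j + 1)"
proof (cases "x \<le> 1")
  case True
  define j where "j = nat \<lfloor>- log 2 x\<rfloor>"
  have "log 2 x \<le> 0"
    using True assms by simp
  then have "real j \<le> - log 2 x" "- log 2 x < real j + 1"
    unfolding j_def by linarith+
  then have "x \<le> 2 powr (- real j)" "2 powr (- (real j + 1)) < x"
    using assms by (auto simp: le_powr_iff powr_less_iff)
  then show ?thesis using that(1) True by blast
next
  case False
  define j where "j = nat \<lfloor>log 2 x\<rfloor>"
  have "0 \<le> log 2 x"
    using False by simp
  then have "real j \<le> log 2 x" "log 2 x \<le> real j + 1"
    unfolding j_def by linarith+
  then have "2 powr real j \<le> x" "x \<le> 2 powr (real j + 1)"
    using assms by (auto simp: le_powr_iff powr_le_iff)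
  then show ?thesis using that(2) False by auto
qed

lemma suminf_geometric_ennreal:
  assumes "0 \<le> K" "0 \<le> (r::real)" "r < 1"
  shows "(\<Sum>j. ennreal (K * r ^ j)) = ennreal (K / (1 - r))"
  using assms sums_mult[OF geometric_sums[of r], of K]
  by (subst suminf_ennreal2) (auto simp: sums_iff)

text \<open>The sum of two geometric series: ratio \<open>2 powr (a - Q)\<close> for the dyadic
  shells inside the unit ball, ratio \<open>2 powr (Q - b)\<close> for those outside. They converge
  when \<open>a < Q\<close> and \<open>Q < b\<close>.\<close>

definition shell_const :: "real \<Rightarrow> real \<Rightarrow> real \<Rightarrow> real" where
  "shell_const Q a b = 2 powr a / (1 - 2 powr (a - Q)) + 2 powr Q / (1 - 2 powr (Q - b))"

lemma powr_less_one_neg: "t < 0 \<Longrightarrow> 2 powr t < (1::real)"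
  using powr_less_mono[of t 0 2] by simp

lemma shell_const_pos: "a < Q \<Longrightarrow> Q < b \<Longrightarrow> 0 < shell_const Q a b"
  unfolding shell_const_def by (intro add_pos_pos divide_pos_pos) (auto simp: powr_less_one_neg)

text \<open>At \<open>m x = 0\<close> the integrand is \<open>0\<close>, because \<open>0 powr u = 0\<close>.\<close>
lemma nn_integral_power_cutoff_le:
  fixes m :: "'a \<Rightarrow> real"
  assumes [measurable]: "m \<in> borel_measurable \<mu>"
    and m0: "\<And>x. 0 \<le> m x"
    and growth: "\<And>t. 0 < t \<Longrightarrow> emeasure \<mu> {x \<in> space \<mu>. m x \<le> t} \<le> ennreal (M * t powr Q)"
    and M: "0 \<le> M" and ab: "0 \<le> a" "a < Q" "Q < b"
  shows "(\<integral>\<^sup>+x. ennreal (if m x \<le> 1 then m x powr (- a) else m x powr (- b)) \<partial>\<mu>)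
          \<le> ennreal (M * shell_const Q a b)"
proof -
  define S where "S t = {x \<in> space \<mu>. m x \<le> t}" for t
  have [measurable]: "S t \<in> sets \<mu>" for t unfolding S_def by measurable
  \<comment> \<open>The indicators are those of whole sublevel sets, which \<open>growth\<close>
    measures, instead of shells; overcounting is harmless in a majorant. Each coefficient is the
    value of the decreasing power at the inner radius of its shell.\<close>
  define g1 where "g1 j x = ennreal (2 powr ((real j + 1) * a)) * indicator (S (2 powr (- real j))) x" for j :: nat and x
  define g2 where "g2 j x = ennreal (2 powr (- (real j * b))) * indicator (S (2 powr (real j + 1))) x" for j :: nat and x
  have [measurable]: "g1 j \<in> borel_measurable \<mu>" "g2 j \<in> borel_measurable \<mu>" for j
    unfolding g1_def g2_def by measurable
  have pw: "ennreal (if m x \<le> 1 then m x powr (- a) else m x powr (- b)) \<le> (\<Sum>j. g1 j x) + (\<Sum>j. g2 j x)"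
    (is "?k \<le> _") if x: "x \<in> space \<mu>" for x
  proof (cases "m x = 0")
    case False
    then have "0 < m x" using m0[of x] by simp
    then show ?thesis
    proof (cases rule: dyadic_shell)
      case (1 j)
      have "m x powr (- a) \<le> (2 powr (- (real j + 1))) powr (- a)"
        using 1 ab by (intro powr_mono2') auto
      also have "\<dots> = 2 powr ((real j + 1) * a)" by (simp add: powr_powr algebra_simps)
      finally have "?k \<le> g1 j x" using 1 x by (simp add: g1_def S_def)
      also have "\<dots> \<le> (\<Sum>j. g1 j x)"
        using sum_le_suminf[of "\<lambda>j. g1 j x" "{j}"] by simp
      finally show ?thesis by (simp add: add_increasing2)
    next
      case (2 j)
      have "m x powr (- b) \<le> (2 powr (real j)) powr (- b)"
        using 2 ab by (intro powr_mono2') auto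
      also have "\<dots> = 2 powr (- (real j * b))" by (simp add: powr_powr algebra_simps)
      finally have "?k \<le> g2 j x" using 2 x by (simp add: g2_def S_def)
      also have "\<dots> \<le> (\<Sum>j. g2 j x)"
        using sum_le_suminf[of "\<lambda>j. g2 j x" "{j}"] by simp
      finally show ?thesis by (simp add: add_increasing)
    qed
  qed simp
  have i1: "(\<integral>\<^sup>+x. g1 j x \<partial>\<mu>) \<le> ennreal (2 powr a * M * (2 powr (a - Q)) ^ j)" for j
  proof -
    have "(\<integral>\<^sup>+x. g1 j x \<partial>\<mu>) = ennreal (2 powr ((real j + 1) * a)) * emeasure \<mu> (S (2 powr (- real j)))"
      unfolding g1_def by (rule nn_integral_cmult_indicator) simp
    also have "\<dots> \<le> ennreal (2 powr ((real j + 1) * a)) * ennreal (M * (2 powr (- real j)) powr Q)"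
      unfolding S_def by (intro mult_left_mono growth) auto
    also have "\<dots> = ennreal (2 powr ((real j + 1) * a) * (M * (2 powr (- real j)) powr Q))"
      by (simp add: ennreal_mult M)
    also have "2 powr ((real j + 1) * a) * (M * (2 powr (- real j)) powr Q) = 2 powr a * M * (2 powr (a - Q)) ^ j"
      by (simp add: powr_powr powr_realpow[symmetric] powr_power)
         (simp add: powr_add[symmetric] algebra_simps flip: powr_add)
    finally show ?thesis .
  qed
  have i2: "(\<integral>\<^sup>+x. g2 j x \<partial>\<mu>) \<le> ennreal (2 powr Q * M * (2 powr (Q - b)) ^ j)" for j
  proof -
    have "(\<integral>\<^sup>+x. g2 j x \<partial>\<mu>) = ennreal (2 powr (- (real j * b))) * emeasure \<mu> (S (2 powr (real j + 1)))"
      unfolding g2_def by (rule nn_integral_cmult_indicator) simp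
    also have "\<dots> \<le> ennreal (2 powr (- (real j * b))) * ennreal (M * (2 powr (real j + 1)) powr Q)"
      unfolding S_def by (intro mult_left_mono growth) auto
    also have "\<dots> = ennreal (2 powr (- (real j * b)) * (M * (2 powr (real j + 1)) powr Q))"
      by (simp add: ennreal_mult M)
    also have "2 powr (- (real j * b)) * (M * (2 powr (real j + 1)) powr Q) = 2 powr Q * M * (2 powr (Q - b)) ^ j"
      by (simp add: powr_powr powr_realpow[symmetric] powr_power)
         (simp add: powr_add[symmetric] algebra_simps flip: powr_add)
    finally show ?thesis .
  qed
  have "(\<integral>\<^sup>+x. ennreal (if m x \<le> 1 then m x powr (- a) else m x powr (- b)) \<partial>\<mu>)
        \<le> (\<integral>\<^sup>+x. (\<Sum>j. g1 j x) + (\<Sum>j. g2 j x) \<partial>\<mu>)"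
    using pw by (rule nn_integral_mono)
  also have "\<dots> = (\<Sum>j. \<integral>\<^sup>+x. g1 j x \<partial>\<mu>) + (\<Sum>j. \<integral>\<^sup>+x. g2 j x \<partial>\<mu>)"
    by (simp add: nn_integral_add nn_integral_suminf)
  also have "\<dots> \<le> (\<Sum>j. ennreal (2 powr a * M * (2 powr (a - Q)) ^ j)) + (\<Sum>j. ennreal (2 powr Q * M * (2 powr (Q - b)) ^ j))"
    by (intro add_mono suminf_le i1 i2) auto
  also have "\<dots> = ennreal (M * shell_const Q a b)"
  proof -
    have "(\<Sum>j. ennreal (2 powr a * M * (2 powr (a - Q)) ^ j)) = ennreal (2 powr a * M / (1 - 2 powr (a - Q)))"
      and "(\<Sum>j. ennreal (2 powr Q * M * (2 powr (Q - b)) ^ j)) = ennreal (2 powr Q * M / (1 - 2 powr (Q - b)))"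
      using ab M by (intro suminf_geometric_ennreal; simp add: powr_less_one_neg)+
    then show ?thesis
      using ab M
      by (simp add: shell_const_def powr_less_one_neg distrib_left mult.commute less_imp_le flip: ennreal_plus)
  qed
  finally show ?thesis .
qed

text \<open>
  With \<open>\<sigma> = s / (1 - s)\<close>, the constant does not depend on \<open>\<rho>\<close> because \<open>(A + \<alpha>) \<sigma> = Q\<close> makes
  the integral of \<open>w powr (- \<sigma>)\<close> invariant under the rescaling \<open>m / \<rho>\<close>.
\<close>
lemma nn_integral_powr_le_weighted:
  fixes m f :: "'a \<Rightarrow> real"
  assumes [measurable]: "m \<in> borel_measurable \<mu>" "f \<in> borel_measurable \<mu>"
    and m0: "\<And>x. 0 \<le> m x" and f0: "\<And>x. 0 \<le> f x"
    and growth: "\<And>t. 0 < t \<Longrightarrow> emeasure \<mu> {x \<in> space \<mu>. m x \<le> t} \<le> ennreal (M * t powr Q)"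
    and M: "0 \<le> M" and Q: "0 < Q" and s: "0 < s" "s < 1" and \<alpha>: "0 \<le> \<alpha>"
    and A: "A = Q * (1 / s - 1) - \<alpha>" "0 < A" "A < l"
    and \<rho>: "0 < \<rho>" and P: "0 < P"
    and le: "(\<integral>\<^sup>+x. ennreal (f x * (\<rho> powr A * m x powr \<alpha> + \<rho> powr (A - l) * m x powr (\<alpha> + l))) \<partial>\<mu>) \<le> ennreal P"
  shows "(\<integral>\<^sup>+x. ennreal (f x powr s) \<partial>\<mu>)
    \<le> ennreal (P powr s * (1 + M * shell_const Q (\<alpha> * (s / (1 - s))) ((\<alpha> + l) * (s / (1 - s)))))"
proof -
  define \<sigma> where "\<sigma> = s / (1 - s)"
  have \<sigma>: "0 < \<sigma>" "1 / s - 1 = 1 / \<sigma>" using s by (auto simp: \<sigma>_def field_simps)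
  have AQ: "(A + \<alpha>) * \<sigma> = Q" unfolding A(1) \<sigma>(2) using \<sigma>(1) by simp
  have ab: "0 \<le> \<alpha> * \<sigma>" "\<alpha> * \<sigma> < Q" "Q < (\<alpha> + l) * \<sigma>"
    using \<alpha> A(2,3) \<sigma>(1) unfolding AQ[symmetric] by auto
  define w where "w x = \<rho> powr A * m x powr \<alpha> + \<rho> powr (A - l) * m x powr (\<alpha> + l)" for x
  define k where "k x = (if m x / \<rho> \<le> 1 then (m x / \<rho>) powr (- (\<alpha> * \<sigma>)) else (m x / \<rho>) powr (- ((\<alpha> + l) * \<sigma>)))" for x
  have [measurable]: "w \<in> borel_measurable \<mu>" "k \<in> borel_measurable \<mu>"
    unfolding w_def k_def by measurable
  have k0: "0 \<le> k x" for x by (simp add: k_def)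
  have w0: "0 \<le> w x" for x by (simp add: w_def)
  have wk: "w x powr (- \<sigma>) \<le> \<rho> powr (- Q) * k x" and wpos: "0 < w x" if "0 < m x" for x
  proof -
    \<comment> \<open>With \<open>m x = \<rho> * z\<close> both summands of \<open>w\<close> carry
      the factor \<open>\<rho> powr (A + \<alpha>)\<close>, so \<open>w\<close> is at least this
      factor times either power of \<open>z\<close>.\<close>
    define z where "z = m x / \<rho>"
    have z: "0 < z" "m x = \<rho> * z" using that \<rho> by (auto simp: z_def)
    have 1: "\<rho> powr (A + \<alpha>) * z powr \<alpha> \<le> w x" "\<rho> powr (A + \<alpha>) * z powr (\<alpha> + l) \<le> w x"
      using z \<rho> by (auto simp: w_def powr_mult powr_diff powr_add field_simps)
    show "0 < w x" using 1(1) z \<rho> by (smt (verit) mult_pos_pos powr_gt_zero)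
    have "w x powr (- \<sigma>) \<le> (\<rho> powr (A + \<alpha>) * z powr \<alpha>) powr (- \<sigma>)"
      "w x powr (- \<sigma>) \<le> (\<rho> powr (A + \<alpha>) * z powr (\<alpha> + l)) powr (- \<sigma>)"
      using 1 z \<rho> \<sigma> by (intro powr_mono2'; simp)+
    then have "w x powr (- \<sigma>) \<le> \<rho> powr (- Q) * z powr (- (\<alpha> * \<sigma>))"
      "w x powr (- \<sigma>) \<le> \<rho> powr (- Q) * z powr (- ((\<alpha> + l) * \<sigma>))"
      using z \<rho> by (simp_all add: powr_mult powr_powr AQ)
    then show "w x powr (- \<sigma>) \<le> \<rho> powr (- Q) * k x"
      by (simp add: k_def z_def)
  qed
  have kint: "(\<integral>\<^sup>+x. ennreal (k x) \<partial>\<mu>) \<le> ennreal ((M * \<rho> powr Q) * shell_const Q (\<alpha> * \<sigma>) ((\<alpha> + l) * \<sigma>))"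
    unfolding k_def
  proof (rule nn_integral_power_cutoff_le[OF _ _ _ _ ab])
    fix t :: real assume "0 < t"
    then show "emeasure \<mu> {x \<in> space \<mu>. m x / \<rho> \<le> t} \<le> ennreal (M * \<rho> powr Q * t powr Q)"
      using growth[of "\<rho> * t"] \<rho> by (simp add: field_simps powr_mult)
  qed (use m0 \<rho> M in auto)
  \<comment> \<open>At zeros of \<open>m\<close> the convention \<open>0 powr u = 0\<close> makes
    \<open>w\<close> and \<open>k\<close> vanish, so the pointwise bound \<open>pw\<close> can fail
    there. Small \<open>t\<close> in \<open>growth\<close> shows that these points form a null set;
    \<open>M + 1\<close> avoids a division by zero.\<close>
  have null: "emeasure \<mu> {x \<in> space \<mu>. m x = 0} = 0"
  proof -
    have "emeasure \<mu> {x \<in> space \<mu>. m x = 0} \<le> 0 + ennreal e" if "0 < e" for e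
    proof -
      define t where "t = (e / (M + 1)) powr (1 / Q)"
      have "0 < t" using that M by (simp add: t_def)
      have "emeasure \<mu> {x \<in> space \<mu>. m x = 0} \<le> emeasure \<mu> {x \<in> space \<mu>. m x \<le> t}"
        using \<open>0 < t\<close> by (intro emeasure_mono) auto
      also have "\<dots> \<le> ennreal (M * t powr Q)" by (rule growth) fact
      also have "M * t powr Q = M * e / (M + 1)" using Q that M by (simp add: t_def powr_powr)
      also have "\<dots> \<le> e" using M that by (simp add: field_simps)
      finally show ?thesis by (simp add: ennreal_leI)
    qed
    then have "emeasure \<mu> {x \<in> space \<mu>. m x = 0} \<le> 0"
      by (rule ennreal_le_epsilon)
    then show ?thesis by simp
  qed
  have ae: "AE x in \<mu>. 0 < m x"
    by (rule AE_I[of _ _ "{x \<in> space \<mu>. m x = 0}"]) (use null in \<open>auto simp: not_less intro: antisym m0\<close>)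
  \<comment> \<open>The identity behind the bound is
    \<open>f x powr s = u powr s * Y powr (1 - s)\<close> with \<open>u = f x * w x\<close> and
    \<open>Y = w x powr (- \<sigma>)\<close>. Comparing \<open>u\<close> with \<open>P * Y\<close>
    takes the place of Young's inequality: small \<open>u\<close> gives the second term, large
    \<open>u\<close> the first. The powers of \<open>P\<close> are chosen so that both terms
    integrate to at most a multiple of \<open>P powr s\<close>.\<close>
  have pw: "f x powr s \<le> P powr (s - 1) * (f x * w x) + P powr s * \<rho> powr (- Q) * k x"
    if "0 < m x" for x
  proof -
    define Y where "Y = w x powr (- \<sigma>)"
    note wp = wpos[OF that]
    have Y: "0 < Y" "Y \<le> \<rho> powr (- Q) * k x" using wk[OF that] wp by (auto simp: Y_def)
    have Ys: "w x powr s * Y powr (1 - s) = 1"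
      using wp s by (simp add: Y_def powr_powr \<sigma>_def flip: powr_add)
    define u where "u = f x * w x"
    have u0: "0 \<le> u" using f0 wp by (simp add: u_def less_imp_le)
    have fs: "f x powr s = u powr s * Y powr (1 - s)"
      using Ys f0[of x] wp by (simp add: u_def powr_mult mult.assoc)
    show ?thesis
    proof (cases "u \<le> P * Y")
      case True
      have "f x powr s \<le> (P * Y) powr s * Y powr (1 - s)"
        unfolding fs using True u0 s by (intro mult_right_mono powr_mono2) auto
      also have "\<dots> = P powr s * Y"
        using Y P by (simp add: powr_mult mult.assoc flip: powr_add)
      also have "\<dots> \<le> P powr s * \<rho> powr (- Q) * k x"
        using Y P by (simp add: mult.assoc mult_left_mono)
      finally show ?thesis using u0 by (simp add: u_def add_increasing)
    next
      case False
      have "0 < u" using False Y P by (smt (verit) mult_pos_pos)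
      have "f x powr s \<le> u powr s * (u / P) powr (1 - s)"
        unfolding fs using False Y P s by (intro mult_left_mono powr_mono2) (auto simp: field_simps)
      also have "\<dots> = P powr (s - 1) * u"
        using \<open>0 < u\<close> P by (simp add: powr_divide powr_diff field_simps)
      finally show ?thesis using k0 by (simp add: u_def add_increasing2)
    qed
  qed
  have "(\<integral>\<^sup>+x. ennreal (f x powr s) \<partial>\<mu>)
     \<le> (\<integral>\<^sup>+x. ennreal (P powr (s - 1)) * ennreal (f x * w x) + ennreal (P powr s * \<rho> powr (- Q)) * ennreal (k x) \<partial>\<mu>)"
    using ae
  proof (intro nn_integral_mono_AE, eventually_elim)
    case (elim x)
    have "ennreal (f x powr s) \<le> ennreal (P powr (s - 1) * (f x * w x) + P powr s * \<rho> powr (- Q) * k x)"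
      by (rule ennreal_leI[OF pw[OF elim(2)]])
    also have "\<dots> = ennreal (P powr (s - 1)) * ennreal (f x * w x) + ennreal (P powr s * \<rho> powr (- Q)) * ennreal (k x)"
      using f0[of x] w0[of x] k0[of x] by (subst ennreal_plus) (auto simp: ennreal_mult)
    finally show ?case .
  qed
  also have "\<dots> = ennreal (P powr (s - 1)) * (\<integral>\<^sup>+x. ennreal (f x * w x) \<partial>\<mu>)
      + ennreal (P powr s * \<rho> powr (- Q)) * (\<integral>\<^sup>+x. ennreal (k x) \<partial>\<mu>)"
    by (simp add: nn_integral_add nn_integral_cmult)
  also have "\<dots> \<le> ennreal (P powr (s - 1)) * ennreal P
      + ennreal (P powr s * \<rho> powr (- Q)) * ennreal ((M * \<rho> powr Q) * shell_const Q (\<alpha> * \<sigma>) ((\<alpha> + l) * \<sigma>))"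
    using le by (intro add_mono mult_left_mono kint) (auto simp: w_def)
  also have "\<dots> = ennreal (P powr (s - 1) * P + P powr s * \<rho> powr (- Q) * ((M * \<rho> powr Q) * shell_const Q (\<alpha> * \<sigma>) ((\<alpha> + l) * \<sigma>)))"
    using P M shell_const_pos[OF ab(2,3)] by (simp add: ennreal_mult less_imp_le)
  also have "P powr (s - 1) * P + P powr s * \<rho> powr (- Q) * ((M * \<rho> powr Q) * shell_const Q (\<alpha> * \<sigma>) ((\<alpha> + l) * \<sigma>))
     = P powr s * (1 + M * shell_const Q (\<alpha> * \<sigma>) ((\<alpha> + l) * \<sigma>))"
    using P \<rho> by (simp add: powr_diff powr_minus field_simps)
  finally show ?thesis unfolding \<sigma>_def .
qed

section \<open>Lebesgue measure: Lipschitz images and sigma-finiteness\<close>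

text \<open>Non-overlapping dyadic cubes of total measure at most
  \<open>measure lebesgue S + e\<close> cover \<open>S\<close>. The part of \<open>S\<close> in a
  cube of side \<open>d\<close> has its image in a cube of side \<open>2 * L * DIM('a) * d\<close>.
  Finally \<open>e\<close> tends to 0.\<close>

lemma measure_lipschitz_image_le:
  fixes f :: "'a::euclidean_space \<Rightarrow> 'a"
  assumes S: "compact S" and L: "L-lipschitz_on S f"
  shows "measure lebesgue (f ` S) \<le> (2 * L * DIM('a)) ^ DIM('a) * measure lebesgue S"
proof -
  let ?n = "DIM('a)"
  have L0: "0 \<le> L" by (rule lipschitz_on_nonneg[OF L])
  \<comment> \<open>The enclosing box is a cube, so its dyadic subdivisions are cubes and the
    measure of a cell is a power of its side.\<close>
  obtain c where c: "0 < c" "S \<subseteq> cbox (- c *\<^sub>R One) (c *\<^sub>R One)"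
  proof -
    obtain B where B: "0 < B" "\<And>x. x \<in> S \<Longrightarrow> norm x \<le> B"
      using compact_imp_bounded[OF S] by (auto simp: bounded_pos)
    then have "S \<subseteq> cbox (- B *\<^sub>R One) (B *\<^sub>R One)"
      by (force simp: mem_box dest: Basis_le_norm[THEN order_trans])
    then show ?thesis using that B by blast
  qed
  have Sm: "S \<in> lmeasurable" using S by (rule lmeasurable_compact)
  have fSm: "f ` S \<in> lmeasurable"
    using compact_continuous_image[OF lipschitz_on_continuous_on[OF L] S] by (rule lmeasurable_compact)
  have "measure lebesgue (f ` S) \<le> (2 * L * ?n) ^ ?n * (measure lebesgue S + e)" if e0: "0 < e" for e
  proof -
    obtain U where U: "open U" "S \<subseteq> U" "U \<in> lmeasurable" "measure lebesgue U < measure lebesgue S + e"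
    proof -
      obtain U where "open U" "S \<subseteq> U" "U - S \<in> lmeasurable" "emeasure lebesgue (U - S) < ennreal e"
        using sets_lebesgue_outer_open[OF fmeasurableD[OF Sm] e0] by blast
      moreover from this have "measure lebesgue (U - S) < e"
        using e0 by (simp add: emeasure_eq_measure2 ennreal_less_iff)
      moreover have "U = S \<union> (U - S)" using \<open>S \<subseteq> U\<close> by blast
      ultimately show ?thesis
        using that Sm measure_Un_le[of S lebesgue "U - S"] fmeasurable.Un[OF Sm, of "U - S"]
        by (metis add_strict_left_mono fmeasurableD le_less_trans)
    qed
    \<comment> \<open>Each cell of the covering lies in the gauge set of one of its points in
      \<open>S\<close>. That set is all of \<open>U\<close>, so the cells stay inside
      \<open>U\<close>.\<close>
    define g where "g x = (if x \<in> U then U else ball x 1)" for x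
    have g: "gauge g" using U by (auto simp: gauge_def g_def)
    have ne: "box (- c *\<^sub>R One) (c *\<^sub>R One :: 'a) \<noteq> {}"
      using c(1) by (simp add: box_ne_empty)
    obtain \<D> where \<D>: "countable \<D>"
      "\<forall>K\<in>\<D>. interior K \<noteq> {} \<and> (\<exists>u v. K = cbox u v)"
      "pairwise (\<lambda>A B. interior A \<inter> interior B = {}) \<D>"
      "\<forall>K\<in>\<D>. \<exists>x\<in>S \<inter> K. K \<subseteq> g x"
      "\<forall>u v. cbox u v \<in> \<D> \<longrightarrow> (\<exists>n. \<forall>i\<in>Basis. v \<bullet> i - u \<bullet> i = 2 * c / 2 ^ n)"
      "S \<subseteq> \<Union>\<D>"
    proof (rule covering_lemma[OF c(2) ne g], goal_cases)
      case (1 \<D>)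
      have "\<forall>u v. cbox u v \<in> \<D> \<longrightarrow> (\<exists>n. \<forall>i\<in>Basis. v \<bullet> i - u \<bullet> i = 2 * c / 2 ^ n)"
      proof (intro allI impI)
        fix u v assume "cbox u v \<in> \<D>"
        from 1(7)[OF this] obtain n where n: "\<And>i. i \<in> Basis \<Longrightarrow>
            v \<bullet> i - u \<bullet> i = ((c *\<^sub>R One) \<bullet> i - (- c *\<^sub>R One) \<bullet> i) / 2 ^ n"
          by metis
        have "v \<bullet> i - u \<bullet> i = 2 * c / 2 ^ n" if "i \<in> Basis" for i
          using n[OF that] that by simp
        then show "\<exists>n. \<forall>i\<in>Basis. v \<bullet> i - u \<bullet> i = 2 * c / 2 ^ n" by blast
      qed
      moreover have "\<forall>K\<in>\<D>. interior K \<noteq> {} \<and> (\<exists>u v. K = cbox u v)" by (intro ballI 1(4))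
      moreover have "\<forall>K\<in>\<D>. \<exists>x\<in>S \<inter> K. K \<subseteq> g x" by (intro ballI 1(6))
      ultimately show ?case by (intro that[OF 1(2) _ 1(5) _ _ 1(8)])
    qed
    have KU: "K \<subseteq> U" if "K \<in> \<D>" for K
    proof -
      from bspec[OF \<D>(4) that] obtain x where x: "x \<in> S \<inter> K" "K \<subseteq> g x" by (rule bexE)
      have "g x = U" using x(1) U(2) by (simp add: g_def subsetD)
      then show ?thesis using x(2) by (simp only:)
    qed
    have Kbd: "f ` (S \<inter> K) \<in> lmeasurable \<and> measure lebesgue (f ` (S \<inter> K)) \<le> (2 * L * ?n) ^ ?n * measure lebesgue K"
      if K: "K \<in> \<D>" for K
    proof -
      obtain u v where uv: "K = cbox u v" using \<D>(2) K by blast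
      obtain n where "\<And>i. i \<in> Basis \<Longrightarrow> v \<bullet> i - u \<bullet> i = 2 * c / 2 ^ n"
        using \<D>(5) K uv by blast
      moreover define d where "d = 2 * c / 2 ^ n"
      ultimately have d: "0 < d" "\<And>i. i \<in> Basis \<Longrightarrow> v \<bullet> i - u \<bullet> i = d"
        using c(1) by (auto simp: d_def)
      have mK: "measure lebesgue K = d ^ ?n"
      proof -
        have "measure lebesgue (cbox u v) = (\<Prod>i\<in>Basis. v \<bullet> i - u \<bullet> i)"
        proof -
          have "\<And>i. i \<in> Basis \<Longrightarrow> u \<bullet> i \<le> v \<bullet> i" using d by fastforce
          then show ?thesis by (simp add: inner_diff_left)
        qed
        also have "\<dots> = d ^ ?n" using d by simp
        finally show ?thesis by (simp add: uv)
      qed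
      obtain x where x: "x \<in> S" "x \<in> K" using \<D>(4) K by blast
      have comp: "compact (f ` (S \<inter> K))"
        unfolding uv by (intro compact_continuous_image continuous_on_subset[OF lipschitz_on_continuous_on[OF L]]
            compact_Int_closed S) auto
      \<comment> \<open>\<open>?n * d\<close> bounds the l1 distance, hence the Euclidean distance,
        between two points of a cube of side \<open>d\<close>.\<close>
      define r where "r = L * (?n * d)"
      have r0: "0 \<le> r" using L0 d by (simp add: r_def)
      have "f ` (S \<inter> K) \<subseteq> cbox (f x - r *\<^sub>R One) (f x + r *\<^sub>R One)"
      proof clarify
        fix y assume y: "y \<in> S" "y \<in> K"
        have "dist y x \<le> (\<Sum>i\<in>Basis. \<bar>(y - x) \<bullet> i\<bar>)" unfolding dist_norm by (rule norm_le_l1)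
        also have "\<dots> \<le> (\<Sum>i\<in>(Basis::'a set). d)"
        proof (rule sum_mono)
          fix i :: 'a assume i: "i \<in> Basis"
          have "u \<bullet> i \<le> x \<bullet> i" "x \<bullet> i \<le> v \<bullet> i" "u \<bullet> i \<le> y \<bullet> i" "y \<bullet> i \<le> v \<bullet> i"
            using x y i by (auto simp: uv mem_box)
          then show "\<bar>(y - x) \<bullet> i\<bar> \<le> d" using d(2)[OF i] by (simp add: inner_diff_left)
        qed
        also have "\<dots> = ?n * d" by simp
        finally have "dist (f y) (f x) \<le> r"
          unfolding r_def using lipschitz_onD[OF L y(1) x(1)] L0 by (smt (verit) mult_left_mono)
        then have "\<bar>(f y - f x) \<bullet> i\<bar> \<le> r" if "i \<in> Basis" for i
          using Basis_le_norm[OF that, of "f y - f x"] by (simp add: dist_norm)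
        then show "f y \<in> cbox (f x - r *\<^sub>R One) (f x + r *\<^sub>R One)"
          by (auto simp: mem_box inner_diff_left inner_add_left) (smt (verit))+
      qed
      then have "measure lebesgue (f ` (S \<inter> K)) \<le> measure lebesgue (cbox (f x - r *\<^sub>R One) (f x + r *\<^sub>R One))"
        using comp by (intro measure_mono_fmeasurable) (auto intro: fmeasurableD lmeasurable_compact)
      also have "\<dots> = (2 * r) ^ ?n"
        using r0 by (simp add: inner_diff_left inner_add_left)
      also have "\<dots> = (2 * L * ?n) ^ ?n * measure lebesgue K"
        unfolding mK r_def power_mult_distrib[symmetric] by (simp only: mult_ac)
      finally show ?thesis using lmeasurable_compact[OF comp] by simp
    qed
    have Km: "K \<in> lmeasurable" if "K \<in> \<D>" for K
      using bspec[OF \<D>(2) that] by (elim conjE exE) simp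
    \<comment> \<open>Distinct cells meet in null sets, so their measures add up to at most that of
      \<open>U\<close>.\<close>
    have sumK: "(\<Sum>K\<in>\<F>. measure lebesgue K) \<le> measure lebesgue S + e" if "\<F> \<subseteq> \<D>" "finite \<F>" for \<F>
    proof -
      have "(\<Sum>K\<in>\<F>. measure lebesgue K) = measure lebesgue (\<Union>\<F>)"
      proof (rule measure_negligible_finite_Union[symmetric])
        show "pairwise (\<lambda>S T. negligible (S \<inter> T)) \<F>"
          unfolding pairwise_def
        proof clarify
          fix A B assume AB: "A \<in> \<F>" "B \<in> \<F>" "A \<noteq> B"
          have "A \<in> \<D>" "B \<in> \<D>" using AB that(1) by (simp_all add: subsetD)
          then have int: "interior (A \<inter> B) = {}"
            using pairwiseD[OF \<D>(3) _ _ AB(3)] by (simp add: interior_Int)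
          obtain a b where A: "A = cbox a b" using bspec[OF \<D>(2) \<open>A \<in> \<D>\<close>] by (elim conjE exE)
          obtain a' b' where B: "B = cbox a' b'" using bspec[OF \<D>(2) \<open>B \<in> \<D>\<close>] by (elim conjE exE)
          show "negligible (A \<inter> B)"
            using int unfolding A B Int_interval interior_cbox negligible_interval .
        qed
      qed (use that Km in auto)
      also have "\<dots> \<le> measure lebesgue U"
      proof (rule measure_mono_fmeasurable)
        show "\<Union>\<F> \<subseteq> U" using that(1) KU by blast
        show "\<Union>\<F> \<in> sets lebesgue"
          using that Km by (intro sets.finite_Union) (auto intro: fmeasurableD)
      qed (rule U)
      finally show ?thesis using U by simp
    qed
    have "measure lebesgue (\<Union>K\<in>\<D>. f ` (S \<inter> K)) \<le> (2 * L * ?n) ^ ?n * (measure lebesgue S + e)"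
    proof (rule measure_UN_bound[OF \<D>(1)])
      fix \<F> assume F: "\<F> \<subseteq> \<D>" "finite \<F>"
      have "measure lebesgue (\<Union>K\<in>\<F>. f ` (S \<inter> K)) \<le> (\<Sum>K\<in>\<F>. measure lebesgue (f ` (S \<inter> K)))"
        using F Kbd by (intro measure_UNION_le) (auto intro: fmeasurableD)
      also have "\<dots> \<le> (\<Sum>K\<in>\<F>. (2 * L * ?n) ^ ?n * measure lebesgue K)"
        using F Kbd by (intro sum_mono) auto
      also have "\<dots> \<le> (2 * L * ?n) ^ ?n * (measure lebesgue S + e)"
        unfolding sum_distrib_left[symmetric] using L0 F by (intro mult_left_mono sumK) auto
      finally show "measure lebesgue (\<Union>K\<in>\<F>. f ` (S \<inter> K)) \<le> (2 * L * ?n) ^ ?n * (measure lebesgue S + e)" .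
    qed (use Kbd in auto)
    moreover have "(\<Union>K\<in>\<D>. f ` (S \<inter> K)) = f ` S" using \<D>(6) by auto
    ultimately show ?thesis by simp
  qed
  note * = this
  show ?thesis
  proof (rule tendsto_lowerbound)
    show "((\<lambda>e. (2 * L * ?n) ^ ?n * (measure lebesgue S + e)) \<longlongrightarrow> (2 * L * ?n) ^ ?n * measure lebesgue S) (at_right 0)"
      by (auto intro!: tendsto_eq_intros)
    show "\<forall>\<^sub>F e in at_right 0. measure lebesgue (f ` S) \<le> (2 * L * ?n) ^ ?n * (measure lebesgue S + e)"
      using * by (auto simp: eventually_at_right_less eventually_at_filter)
  qed auto
qed

lemma sigma_finite_lebesgue: "sigma_finite_measure (lebesgue :: 'a::euclidean_space measure)"
proof
  show "\<exists>A. countable A \<and> A \<subseteq> sets (lebesgue :: 'a measure) \<and> \<Union>A = space lebesgue \<and> (\<forall>a\<in>A. emeasure lebesgue a \<noteq> \<infinity>)"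
  proof (intro exI conjI ballI)
    show "\<Union>(range (\<lambda>n::nat. cball (0::'a) n)) = space lebesgue"
      by (auto simp: real_arch_simple)
    fix a assume "a \<in> range (\<lambda>n::nat. cball (0::'a) n)"
    then have "a \<in> lmeasurable" by auto
    then show "emeasure lebesgue a \<noteq> \<infinity>" using emeasure_eq_measure2[of a lebesgue] by simp
  qed auto
qed

section \<open>From two one-sided bounds to a bilinear bound\<close>

text \<open>When \<open>\<rho> powr (A + B) = i / (u * v)\<close>, the two summands of each bound
  coincide, whence a factor 2 from each. In the product the powers of \<open>\<rho>\<close> combine
  to \<open>i / (u * v)\<close>.\<close>

lemma product_le_of_weighted_bounds:
  fixes F H i u v A B C\<^sub>1 C\<^sub>2 :: real
  assumes "0 < u" "0 < v" "0 < i" "0 < C\<^sub>1" "0 < C\<^sub>2" "0 \<le> F" "0 \<le> H" "0 < A" "0 < B"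
    and F: "\<And>\<rho>. 0 < \<rho> \<Longrightarrow> F * v \<le> C\<^sub>1 * (\<rho> powr A * (u * v) + \<rho> powr (- B) * i)"
    and H: "\<And>\<rho>. 0 < \<rho> \<Longrightarrow> H * u \<le> C\<^sub>2 * (\<rho> powr B * (u * v) + \<rho> powr (- A) * i)"
  shows "F * H \<le> 4 * C\<^sub>1 * C\<^sub>2 * i"
proof -
  define w where "w = i / (u * v)"
  define \<rho> where "\<rho> = w powr (1 / (A + B))"
  have w: "0 < w" "i = w * (u * v)" using assms by (auto simp: w_def)
  have \<rho>: "0 < \<rho>" using w by (simp add: \<rho>_def)
  have \<rho>AB: "\<rho> powr A * \<rho> powr B = w"
    using assms w by (simp add: \<rho>_def powr_powr flip: powr_add add_divide_distrib)
  have "\<rho> powr (- B) * w = \<rho> powr A" "\<rho> powr (- A) * w = \<rho> powr B"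
    using \<rho> by (simp_all add: powr_minus flip: \<rho>AB)
  then have \<rho>i: "\<rho> powr (- B) * i = \<rho> powr A * (u * v)" "\<rho> powr (- A) * i = \<rho> powr B * (u * v)"
    unfolding w(2) by (simp_all only: flip: mult.assoc)
  have "F * v \<le> C\<^sub>1 * (2 * \<rho> powr A * (u * v))" "H * u \<le> C\<^sub>2 * (2 * \<rho> powr B * (u * v))"
    using F[OF \<rho>] H[OF \<rho>] unfolding \<rho>i by (simp_all add: algebra_simps)
  then have "F \<le> 2 * C\<^sub>1 * \<rho> powr A * u" "H \<le> 2 * C\<^sub>2 * \<rho> powr B * v"
    using \<open>0 < u\<close> \<open>0 < v\<close> by (simp_all add: mult_ac)
  then have "F * H \<le> (2 * C\<^sub>1 * \<rho> powr A * u) * (2 * C\<^sub>2 * \<rho> powr B * v)"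
    using assms by (intro mult_mono) auto
  also have "\<dots> = 4 * C\<^sub>1 * C\<^sub>2 * ((\<rho> powr A * \<rho> powr B) * (u * v))"
    by (simp add: mult_ac)
  finally show ?thesis by (simp add: \<rho>AB w(2))
qed

text \<open>Since \<open>F\<close> does not depend on \<open>y\<close>, multiplying
  \<open>le\<close> by \<open>g y\<close> and integrating over \<open>y\<close> brings in the double
  integral.\<close>

lemma (in sigma_finite_measure) integrate_weighted_bound:
  fixes u g :: "'a \<Rightarrow> ennreal" and k :: "'a \<Rightarrow> 'a \<Rightarrow> ennreal"
  assumes [measurable]: "u \<in> borel_measurable M" "g \<in> borel_measurable M"
    "case_prod k \<in> borel_measurable (M \<Otimes>\<^sub>M M)"
    and le: "\<And>y. F \<le> a * (\<integral>\<^sup>+x. u x \<partial>M) + b * (\<integral>\<^sup>+x. k x y * u x \<partial>M)"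
  shows "F * (\<integral>\<^sup>+y. g y \<partial>M) \<le> a * ((\<integral>\<^sup>+x. u x \<partial>M) * (\<integral>\<^sup>+y. g y \<partial>M))
    + b * (\<integral>\<^sup>+y. (\<integral>\<^sup>+x. k x y * u x * g y \<partial>M) \<partial>M)"
proof -
  define U where "U = (\<integral>\<^sup>+x. u x \<partial>M)"
  have "F * (\<integral>\<^sup>+y. g y \<partial>M) = (\<integral>\<^sup>+y. F * g y \<partial>M)"
    by (simp add: nn_integral_cmult)
  also have "\<dots> \<le> (\<integral>\<^sup>+y. (a * U) * g y + b * (\<integral>\<^sup>+x. k x y * u x * g y \<partial>M) \<partial>M)"
  proof (rule nn_integral_mono)
    fix y assume [simp]: "y \<in> space M"
    have "F * g y \<le> (a * U + b * (\<integral>\<^sup>+x. k x y * u x \<partial>M)) * g y"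
      unfolding U_def by (intro mult_right_mono le) simp
    also have "\<dots> = (a * U) * g y + b * (\<integral>\<^sup>+x. k x y * u x * g y \<partial>M)"
      by (subst nn_integral_multc) (measurable, simp add: distrib_right mult.assoc)
    finally show "F * g y \<le> (a * U) * g y + b * (\<integral>\<^sup>+x. k x y * u x * g y \<partial>M)" .
  qed
  also have "\<dots> = (a * U) * (\<integral>\<^sup>+y. g y \<partial>M) + b * (\<integral>\<^sup>+y. (\<integral>\<^sup>+x. k x y * u x * g y \<partial>M) \<partial>M)"
    by (simp add: nn_integral_add nn_integral_cmult)
  finally show ?thesis by (simp add: U_def mult.assoc)
qed

text \<open>\<open>integrate_weighted_bound\<close>, applied to \<open>u\<close>, \<open>g\<close>
  and then with their roles exchanged, yields the two bounds required by
  \<open>product_le_of_weighted_bounds\<close>. Fubini and the symmetry of \<open>k\<close> identify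
  the two double integrals.\<close>

lemma (in sigma_finite_measure) bilinear_form_ge:
  fixes u g :: "'a \<Rightarrow> ennreal" and k :: "'a \<Rightarrow> 'a \<Rightarrow> ennreal"
  assumes meas [measurable]: "u \<in> borel_measurable M" "g \<in> borel_measurable M"
    "case_prod k \<in> borel_measurable (M \<Otimes>\<^sub>M M)"
    and sym: "\<And>x y. k x y = k y x"
    and C: "0 < C\<^sub>1" "0 < C\<^sub>2" and FH: "0 \<le> F" "0 \<le> H" and AB: "0 < A" "0 < B"
    and F: "\<And>y \<rho>. 0 < \<rho> \<Longrightarrow> ennreal F \<le> ennreal (C\<^sub>1 * \<rho> powr A) * (\<integral>\<^sup>+x. u x \<partial>M)
      + ennreal (C\<^sub>1 * \<rho> powr (- B)) * (\<integral>\<^sup>+x. k x y * u x \<partial>M)"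
    and H: "\<And>y \<rho>. 0 < \<rho> \<Longrightarrow> ennreal H \<le> ennreal (C\<^sub>2 * \<rho> powr B) * (\<integral>\<^sup>+x. g x \<partial>M)
      + ennreal (C\<^sub>2 * \<rho> powr (- A)) * (\<integral>\<^sup>+x. k x y * g x \<partial>M)"
    and fin: "(\<integral>\<^sup>+x. u x \<partial>M) < \<infinity>" "(\<integral>\<^sup>+x. g x \<partial>M) < \<infinity>"
  shows "ennreal (F * H) \<le> ennreal (4 * C\<^sub>1 * C\<^sub>2) * (\<integral>\<^sup>+y. (\<integral>\<^sup>+x. k x y * u x * g y \<partial>M) \<partial>M)"
proof -
  have pair: "pair_sigma_finite M M" by unfold_locales
  define I where "I = (\<integral>\<^sup>+y. (\<integral>\<^sup>+x. k x y * u x * g y \<partial>M) \<partial>M)"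
  have I': "(\<integral>\<^sup>+y. (\<integral>\<^sup>+x. k x y * g x * u y \<partial>M) \<partial>M) = I"
  proof -
    have "I = (\<integral>\<^sup>+x. (\<integral>\<^sup>+y. k x y * u x * g y \<partial>M) \<partial>M)"
      unfolding I_def by (rule pair_sigma_finite.Fubini'[OF pair]) measurable
    also have "\<dots> = (\<integral>\<^sup>+y. (\<integral>\<^sup>+x. k x y * g x * u y \<partial>M) \<partial>M)"
      by (subst sym) (simp add: mult_ac)
    finally show ?thesis by simp
  qed
  \<comment> \<open>A vanishing mass makes \<open>w\<close> zero almost everywhere, so both terms on
    the right vanish for any \<open>y\<close> and \<open>\<rho>\<close>. This settles the cases in
    which dividing by a mass is impossible.\<close>
  have zero: "X = 0" if X: "\<And>y \<rho>. 0 < \<rho> \<Longrightarrow> ennreal X \<le> ennreal (c \<rho>) * (\<integral>\<^sup>+x. w x \<partial>M) + ennreal (d \<rho>) * (\<integral>\<^sup>+x. k x y * w x \<partial>M)"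
    and w: "(\<integral>\<^sup>+x. w x \<partial>M) = 0" and [measurable]: "w \<in> borel_measurable M" and "0 \<le> X"
    for X :: real and c d :: "real \<Rightarrow> real" and w
  proof -
    have "AE x in M. w x = 0" using w by (simp add: nn_integral_0_iff_AE)
    then have "(\<integral>\<^sup>+x. k x y * w x \<partial>M) = (\<integral>\<^sup>+x. 0 \<partial>M)" for y
      by (intro nn_integral_cong_AE) auto
    then show ?thesis using X[of 1 undefined] w \<open>0 \<le> X\<close> by (simp add: ennreal_eq_0_iff)
  qed
  show ?thesis
  proof (cases "I = \<infinity> \<or> (\<integral>\<^sup>+x. u x \<partial>M) = 0 \<or> (\<integral>\<^sup>+x. g x \<partial>M) = 0")
    case True
    then consider "I = \<infinity>" | "F = 0" | "H = 0"
      using zero[OF F _ _ FH(1)] zero[OF H _ _ FH(2)] by auto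
    then show ?thesis
    proof cases
      case 1
      then show ?thesis using C by (simp add: I_def[symmetric] ennreal_mult_top)
    qed auto
  next
    case False
    obtain u' where u': "0 < u'" "(\<integral>\<^sup>+x. u x \<partial>M) = ennreal u'"
      using fin(1) False by (cases "\<integral>\<^sup>+x. u x \<partial>M") (auto simp: less_le)
    obtain v' where v': "0 < v'" "(\<integral>\<^sup>+x. g x \<partial>M) = ennreal v'"
      using fin(2) False by (cases "\<integral>\<^sup>+x. g x \<partial>M") (auto simp: less_le)
    obtain i where i: "0 \<le> i" "I = ennreal i"
      using False by (cases I) auto
    have F': "F * v' \<le> C\<^sub>1 * (\<rho> powr A * (u' * v') + \<rho> powr (- B) * i)" if "0 < \<rho>" for \<rho>
    proof -
      have "ennreal (F * v') \<le> ennreal (C\<^sub>1 * \<rho> powr A * (u' * v') + C\<^sub>1 * \<rho> powr (- B) * i)"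
        using integrate_weighted_bound[OF meas F[OF that]] C FH u'(1) v'(1) i(1) that
        by (simp add: u'(2) v'(2) i(2) I_def[symmetric] ennreal_mult)
      then have "F * v' \<le> C\<^sub>1 * \<rho> powr A * (u' * v') + C\<^sub>1 * \<rho> powr (- B) * i"
        by (rule iffD1[OF ennreal_le_iff, rotated]) (use C u'(1) v'(1) i(1) in simp)
      then show ?thesis by (simp add: distrib_left mult.assoc)
    qed
    have H': "H * u' \<le> C\<^sub>2 * (\<rho> powr B * (u' * v') + \<rho> powr (- A) * i)" if "0 < \<rho>" for \<rho>
    proof -
      have "ennreal (H * u') \<le> ennreal (C\<^sub>2 * \<rho> powr B * (v' * u') + C\<^sub>2 * \<rho> powr (- A) * i)"
        using integrate_weighted_bound[OF meas(2,1,3) H[OF that]] C FH u'(1) v'(1) i(1) that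
        by (simp add: u'(2) v'(2) i(2) I' ennreal_mult)
      then have "H * u' \<le> C\<^sub>2 * \<rho> powr B * (v' * u') + C\<^sub>2 * \<rho> powr (- A) * i"
        by (rule iffD1[OF ennreal_le_iff, rotated]) (use C u'(1) v'(1) i(1) in simp)
      then show ?thesis by (simp add: distrib_left mult_ac)
    qed
    \<comment> \<open>Balancing requires a positive double integral, but \<open>i\<close> may be 0;
      \<open>i + e'\<close> stands in for it.\<close>
    have "F * H \<le> 4 * C\<^sub>1 * C\<^sub>2 * i + e" if "0 < e" for e
    proof -
      define e' where "e' = e / (4 * C\<^sub>1 * C\<^sub>2)"
      have e': "0 < e'" "4 * C\<^sub>1 * C\<^sub>2 * e' = e" using that C by (auto simp: e'_def)
      have "F * H \<le> 4 * C\<^sub>1 * C\<^sub>2 * (i + e')"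
      proof (rule product_le_of_weighted_bounds[OF u'(1) v'(1) _ C FH AB])
        fix \<rho> :: real assume \<rho>: "0 < \<rho>"
        have "C\<^sub>1 * (\<rho> powr A * (u' * v') + \<rho> powr (- B) * i) \<le> C\<^sub>1 * (\<rho> powr A * (u' * v') + \<rho> powr (- B) * (i + e'))"
          using C e'(1) by (intro mult_left_mono add_left_mono) auto
        with F'[OF \<rho>] show "F * v' \<le> C\<^sub>1 * (\<rho> powr A * (u' * v') + \<rho> powr (- B) * (i + e'))"
          by (rule order_trans)
        have "C\<^sub>2 * (\<rho> powr B * (u' * v') + \<rho> powr (- A) * i) \<le> C\<^sub>2 * (\<rho> powr B * (u' * v') + \<rho> powr (- A) * (i + e'))"
          using C e'(1) by (intro mult_left_mono add_left_mono) auto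
        with H'[OF \<rho>] show "H * u' \<le> C\<^sub>2 * (\<rho> powr B * (u' * v') + \<rho> powr (- A) * (i + e'))"
          by (rule order_trans)
      qed (use i e' in auto)
      then show ?thesis by (simp add: distrib_left e'(2))
    qed
    then have "F * H \<le> 4 * C\<^sub>1 * C\<^sub>2 * i" by (rule field_le_epsilon)
    then have "ennreal (F * H) \<le> ennreal (4 * C\<^sub>1 * C\<^sub>2 * i)" by (rule ennreal_leI)
    also have "\<dots> = ennreal (4 * C\<^sub>1 * C\<^sub>2) * I"
      using C i by (simp add: ennreal_mult)
    finally show ?thesis by (simp add: I_def)
  qed
qed

section \<open>Dilations and left translations of a homogeneous group\<close>

context homogeneous_group
begin

abbreviation "Q \<equiv> hom_dim \<nu>"

lemma in_carrier [simp]: "x \<in> carrier G"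
  by (simp add: carrier_UNIV)

lemma hom_dim_pos: "0 < Q"
  unfolding hom_dim_def by (intro sum_pos weights_pos) auto

lemma dilation_mult: "0 < r \<Longrightarrow> dilation \<nu> r (x \<otimes> y) = dilation \<nu> r x \<otimes> dilation \<nu> r y"
  using dilation_automorphism[of r] by (auto simp: iso_def hom_def)

lemma dilation_dilation: "0 < r \<Longrightarrow> 0 < s \<Longrightarrow> dilation \<nu> r (dilation \<nu> s x) = dilation \<nu> (r * s) x"
  by (simp add: dilation_def vec_eq_iff powr_mult)

lemma dilation_1: "dilation \<nu> 1 x = x"
  by (simp add: dilation_def vec_eq_iff)

lemma differentiable_mult: "(\<lambda>(x, y). x \<otimes> y) differentiable (at z)"
proof -
  have "Ck (Suc 0) (\<lambda>(x, y). x \<otimes> y)"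
    using smooth_mult unfolding smooth_def by (rule spec)
  then show ?thesis by (simp only: Ck.simps)
qed

lemma continuous_on_mult: "continuous_on UNIV (\<lambda>(x, y). x \<otimes> y)"
  using differentiable_mult
  by (meson continuous_at_imp_continuous_on differentiable_imp_continuous_within)

lemma continuous_on_lmult: "continuous_on UNIV ((\<otimes>) y)"
proof -
  have "continuous_on UNIV (\<lambda>x. (\<lambda>(x, y). x \<otimes> y) (y, x))"
    by (rule continuous_on_compose2[OF continuous_on_mult]) (auto intro!: continuous_intros)
  then show ?thesis by simp
qed

text \<open>The derivative of the product map is continuous, hence bounded on the compact convex
  unit ball of pairs, and one Lipschitz constant results. Two points of norm at most 1/2 form a pair
  in that ball.\<close>

lemma local_lipschitz_lmult:
   "\<exists>L. \<forall>y\<in>cball 0 (1/2). L-lipschitz_on (cball 0 (1/2)) ((\<otimes>) y)"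
proof -
  define F where "F = (\<lambda>(x, y). x \<otimes> y)"
  define D where "D z = frechet_derivative F (at z)" for z
  have der: "(F has_derivative D z) (at z)" for z
    unfolding D_def F_def by (rule iffD1[OF frechet_derivative_works differentiable_mult])
  have "Ck (Suc 0) F"
    using smooth_mult unfolding smooth_def F_def by (rule spec)
  then have "continuous_on UNIV (\<lambda>z. D z v)" for v
    by (simp only: Ck.simps D_def)
  \<comment> \<open>\<open>Ck\<close> speaks of directional derivatives; the sum of their norms over
    the basis dominates the operator norm.\<close>
  then have "continuous_on UNIV (\<lambda>z. \<Sum>b\<in>Basis. norm (D z b))"
    by (intro continuous_on_sum continuous_on_norm)
  then have "continuous_on (cball 0 1) (\<lambda>z. \<Sum>b\<in>Basis. norm (D z b))"
    by (rule continuous_on_subset) simp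
  then have "bounded ((\<lambda>z. \<Sum>b\<in>Basis. norm (D z b)) ` cball 0 1)"
    by (intro compact_imp_bounded compact_continuous_image compact_cball)
  then obtain C where "\<forall>u\<in>(\<lambda>z. \<Sum>b\<in>Basis. norm (D z b)) ` cball 0 1. \<bar>u\<bar> \<le> C"
    unfolding bounded_real by (rule exE)
  then have C: "\<bar>\<Sum>b\<in>Basis. norm (D z b)\<bar> \<le> C" if "z \<in> cball 0 1" for z
    using that by (rule bspec[OF _ imageI])
  have C0: "0 \<le> C" using C[of 0] by simp
  have "C-lipschitz_on (cball 0 1) F"
  proof (rule bounded_derivative_imp_lipschitz)
    fix z :: "(real ^ 'n) \<times> (real ^ 'n)" assume z: "z \<in> cball 0 1"
    show "(F has_derivative D z) (at z within cball 0 1)"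
      using der by (rule has_derivative_at_withinI)
    have "onorm (D z) \<le> (\<Sum>b\<in>Basis. norm (D z b))"
      by (rule onorm_componentwise[OF has_derivative_bounded_linear[OF der]])
    then show "onorm (D z) \<le> C" using C[OF z] by linarith
  qed (use C0 in auto)
  then have *: "dist (F z) (F z') \<le> C * dist z z'" if "z \<in> cball 0 1" "z' \<in> cball 0 1" for z z'
    using that by (rule lipschitz_onD)
  have "C-lipschitz_on (cball 0 (1/2)) ((\<otimes>) y)" if y: "y \<in> cball 0 (1/2)" for y
  proof (rule lipschitz_onI[OF _ C0])
    fix x x' :: "real ^ 'n" assume x: "x \<in> cball 0 (1/2)" "x' \<in> cball 0 (1/2)"
    have "(y, u) \<in> cball 0 1" if "u \<in> cball 0 (1/2)" for u :: "real ^ 'n"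
      using norm_Pair_le[of y u] y that by simp
    then show "dist (y \<otimes> x) (y \<otimes> x') \<le> C * dist x x'"
      using *[of "(y, x)" "(y, x')"] x by (simp add: F_def dist_Pair_Pair)
  qed
  then show ?thesis by (intro exI ballI)
qed

lemma measure_dilation_image:
  assumes "A \<in> lmeasurable" "0 < r"
  shows "measure lebesgue (dilation \<nu> r ` A) = r powr Q * measure lebesgue A"
proof -
  have "(\<Prod>i\<in>UNIV. r powr \<nu> i) = r powr Q"
    using assms by (simp add: hom_dim_def powr_sum)
  then show ?thesis
    using measure_stretch[OF assms(1), of "\<lambda>i. r powr \<nu> i"]
    unfolding dilation_def[abs_def] by simp
qed

lemma continuous_on_dilation: "continuous_on A (dilation \<nu> r)"
  unfolding dilation_def[abs_def] by (intro continuous_intros)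

end

section \<open>Balls of the quasi-norm and their left translates\<close>

locale homogeneous_quasi_normed_group = homogeneous_group +
  fixes N :: "real ^ 'a \<Rightarrow> real"
  assumes quasi_norm: "homogeneous_quasi_norm G \<nu> N"
begin

lemma continuous_on_N: "continuous_on A N"
  using quasi_norm continuous_on_subset unfolding homogeneous_quasi_norm_def by blast

lemma N_nonneg [simp]: "0 \<le> N x"
  and N_inv [simp]: "N (inv x) = N x"
  and N_dilation: "0 < r \<Longrightarrow> N (dilation \<nu> r x) = r * N x"
  and N_eq_0_iff: "N x = 0 \<longleftrightarrow> x = 0"
  using quasi_norm unfolding homogeneous_quasi_norm_def by auto

text \<open>\<open>N\<close> has a positive minimum on the sphere of radius \<open>\<delta>\<close>,
  and \<open>c\<close> is half of it. A point beyond the sphere is moved onto it by a dilation with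
  \<open>r \<le> 1\<close>, which does not increase \<open>N\<close>, so its own value is at least
  the minimum.\<close>

lemma small_N_imp_small_norm:
  assumes \<delta>: "0 < \<delta>"
  obtains c where "0 < c" "\<And>x. N x \<le> c \<Longrightarrow> norm x \<le> \<delta>"
proof -
  have "\<exists>x\<in>sphere 0 \<delta>. \<forall>y\<in>sphere 0 \<delta>. N x \<le> N y"
    using \<delta> by (intro continuous_attains_inf continuous_on_N) auto
  then obtain z where z: "z \<in> sphere 0 \<delta>" "\<And>y. y \<in> sphere 0 \<delta> \<Longrightarrow> N z \<le> N y" by blast
  have "z \<noteq> 0" using z(1) \<delta> by auto
  then have Nz: "0 < N z" using N_nonneg[of z] N_eq_0_iff[of z] by linarith
  have "norm x \<le> \<delta>" if "N x \<le> N z / 2" for x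
  proof (rule ccontr)
    assume "\<not> norm x \<le> \<delta>"
    then have x: "\<delta> < norm x" by simp
    \<comment> \<open>The weights are positive and \<open>0 powr u = 0\<close>, so the path is
      continuous up to \<open>r = 0\<close> and joins 0 to \<open>x\<close>.\<close>
    have "continuous_on {0..1} (\<lambda>r. norm (dilation \<nu> r x))"
      unfolding dilation_def using weights_pos by (intro continuous_intros continuous_on_powr') auto
    moreover have "dilation \<nu> 0 x = 0" by (simp add: dilation_def vec_eq_iff)
    ultimately have "\<exists>r\<ge>0. r \<le> 1 \<and> norm (dilation \<nu> r x) = \<delta>"
      using x \<delta> by (intro IVT') (auto simp: dilation_1)
    then obtain r where r: "0 \<le> r" "r \<le> 1" "norm (dilation \<nu> r x) = \<delta>" by blast
    then have "r \<noteq> 0" using \<open>dilation \<nu> 0 x = 0\<close> \<delta> by auto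
    then have "N z \<le> r * N x" using z(2)[of "dilation \<nu> r x"] r by (simp add: N_dilation)
    also have "\<dots> \<le> 1 * N x" using r by (intro mult_right_mono) auto
    finally show False using that Nz by simp
  qed
  then show thesis using that[of "N z / 2"] Nz by simp
qed

lemma dilation_N_ball:
  assumes "0 < r"
  shows "dilation \<nu> r ` {x. N x \<le> t} = {x. N x \<le> r * t}"
proof -
  have "x \<in> dilation \<nu> r ` {x. N x \<le> t}" if "N x \<le> r * t" for x
  proof (rule image_eqI)
    show "x = dilation \<nu> r (dilation \<nu> (1 / r) x)"
      using assms by (simp add: dilation_dilation dilation_1)
    show "dilation \<nu> (1 / r) x \<in> {x. N x \<le> t}"
      using assms that by (simp add: N_dilation field_simps)
  qed
  then show ?thesis using assms by (auto simp: N_dilation)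
qed

text \<open>A ball of small radius \<open>c\<close> is closed and bounded; dilations carry its
  compactness to every radius.\<close>

lemma compact_N_ball:
  assumes "0 < t"
  shows "compact {x. N x \<le> t}"
proof -
  obtain c where c: "0 < c" "\<And>x. N x \<le> c \<Longrightarrow> norm x \<le> 1"
    using small_N_imp_small_norm[of 1] by auto
  have "compact {x. N x \<le> c}"
    unfolding compact_eq_bounded_closed using c(2)
    by (auto simp: bounded_iff intro!: closed_Collect_le continuous_on_N)
  then have "compact (dilation \<nu> (t / c) ` {x. N x \<le> c})"
    by (intro compact_continuous_image continuous_on_dilation)
  then show ?thesis using assms c(1) by (simp add: dilation_N_ball)
qed

lemma measure_N_ball:
  assumes "0 < t"
  shows "measure lebesgue {x. N x \<le> t} = t powr Q * measure lebesgue {x. N x \<le> 1}"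
  using measure_dilation_image[OF lmeasurable_compact[OF compact_N_ball[of 1]] assms]
  by (simp add: dilation_N_ball assms)

text \<open>
  A dilation moves \<open>y\<close> and the ball near \<open>0\<close>, where left translations are uniformly Lipschitz, so
  invariance of Lebesgue measure is not needed.
\<close>
lemma measure_translated_N_ball:
  "\<exists>M\<ge>0. \<forall>y. \<forall>t>0. emeasure lebesgue {x. N (inv y \<otimes> x) \<le> t} \<le> ennreal (M * t powr Q)"
proof -
  obtain L where L: "\<forall>y\<in>cball 0 (1/2). L-lipschitz_on (cball 0 (1/2)) ((\<otimes>) y)"
    using local_lipschitz_lmult by (rule exE)
  obtain c where c: "0 < c" "\<And>x. N x \<le> c \<Longrightarrow> norm x \<le> 1/2"
    using small_N_imp_small_norm[of "1/2"] by auto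
  define K where "K = (2 * L * CARD('a)) ^ CARD('a)"
  have "0 \<le> L" using bspec[OF L, of 0] by (simp add: lipschitz_on_nonneg)
  then have K0: "0 \<le> K" by (simp add: K_def)
  define M where "M = K * measure lebesgue {x. N x \<le> 1}"
  have M0: "0 \<le> M" using K0 by (simp add: M_def)
  have "emeasure lebesgue {x. N (inv y \<otimes> x) \<le> t} \<le> ennreal (M * t powr Q)" if t: "0 < t" for y t
  proof -
    \<comment> \<open>With this scale \<open>r * t\<close> and \<open>r * N y\<close> add up to
      \<open>c\<close>, so the dilated ball and the dilated \<open>y\<close> both lie where left
      translations share the constant \<open>L\<close>.\<close>
    define r where "r = c / (t + N y)"
    have pos: "0 < t + N y" using t N_nonneg[of y] by linarith
    have r0: "0 < r" using c(1) pos by (simp add: r_def)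
    have rt: "r * t \<le> c" "r * N y \<le> c"
      using c(1) pos t by (simp_all add: r_def field_simps)
    define y' where "y' = dilation \<nu> r y"
    define B where "B = {x. N x \<le> r * t}"
    have cB: "compact B" unfolding B_def using r0 t by (intro compact_N_ball) auto
    have "B \<subseteq> cball 0 (1/2)" using c(2) rt(1) by (auto simp: B_def)
    moreover have "y' \<in> cball 0 (1/2)"
      using c(2)[of y'] rt(2) r0 by (simp add: y'_def N_dilation)
    ultimately have lip: "L-lipschitz_on B ((\<otimes>) y')" using lipschitz_on_subset[OF bspec[OF L]] by blast
    have "{x. N (inv y \<otimes> x) \<le> t} = (\<otimes>) y ` {x. N x \<le> t}"
    proof -
      have "x \<in> (\<otimes>) y ` {x. N x \<le> t}" if "N (inv y \<otimes> x) \<le> t" for x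
        by (rule image_eqI[of _ _ "inv y \<otimes> x"]) (use that in \<open>auto simp flip: m_assoc\<close>)
      then show ?thesis by (auto simp flip: m_assoc)
    qed
    also have "\<dots> = dilation \<nu> (1 / r) ` ((\<otimes>) y' ` B)"
    proof -
      have "dilation \<nu> (1 / r) ` ((\<otimes>) y' ` B) = (\<lambda>x. y \<otimes> x) ` (dilation \<nu> (1 / r) ` B)"
        unfolding image_image using r0
        by (intro image_cong) (auto simp: dilation_mult y'_def dilation_dilation dilation_1)
      also have "dilation \<nu> (1 / r) ` B = {x. N x \<le> t}"
        unfolding B_def using r0 by (subst dilation_N_ball) auto
      finally show ?thesis by simp
    qed
    finally have eq: "{x. N (inv y \<otimes> x) \<le> t} = dilation \<nu> (1 / r) ` ((\<otimes>) y' ` B)" .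
    have ci: "compact ((\<otimes>) y' ` B)"
      using lipschitz_on_continuous_on[OF lip] cB by (rule compact_continuous_image)
    have cc: "compact {x. N (inv y \<otimes> x) \<le> t}"
      unfolding eq by (rule compact_continuous_image[OF continuous_on_dilation ci])
    have "measure lebesgue {x. N (inv y \<otimes> x) \<le> t} = (1 / r) powr Q * measure lebesgue ((\<otimes>) y' ` B)"
      unfolding eq using r0 by (intro measure_dilation_image lmeasurable_compact ci) auto
    also have "\<dots> \<le> (1 / r) powr Q * (K * measure lebesgue B)"
      using measure_lipschitz_image_le[OF cB lip] by (intro mult_left_mono) (auto simp: K_def)
    also have "measure lebesgue B = (r * t) powr Q * measure lebesgue {x. N x \<le> 1}"
      unfolding B_def using r0 t by (intro measure_N_ball) auto
    \<comment> \<open>The dependence on \<open>y\<close> sits in \<open>r\<close> alone, and its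
      powers cancel.\<close>
    also have "(1 / r) powr Q * (K * ((r * t) powr Q * measure lebesgue {x. N x \<le> 1})) = M * t powr Q"
      using r0 t by (simp add: M_def powr_mult powr_divide)
    finally show ?thesis
      using lmeasurable_compact[OF cc] by (simp add: emeasure_eq_measure2 ennreal_leI)
  qed
  with M0 show ?thesis by (intro exI[of _ M]) simp
qed

end

section \<open>Measurability and the one-sided norm estimate\<close>

context homogeneous_quasi_normed_group
begin

lemma measurable_N [measurable]: "N \<in> borel_measurable borel"
  using continuous_on_N by (rule borel_measurable_continuous_onI)

lemma measurable_N_lmult [measurable]: "(\<lambda>x. N (y \<otimes> x)) \<in> borel_measurable borel"
  by (intro borel_measurable_continuous_onI continuous_on_compose2[OF continuous_on_N[of UNIV] continuous_on_lmult]) auto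

lemma continuous_on_inv: "continuous_on UNIV (\<lambda>x. inv x)"
proof -
  have "Ck 0 (\<lambda>x. inv x)" using smooth_inv unfolding smooth_def by (rule spec)
  then show ?thesis by simp
qed

text \<open>Continuity gives Borel measurability on the product; the identity from
  \<open>lebesgue\<close> to \<open>borel\<close> in each coordinate transfers it to the product of
  the completed measures.\<close>

lemma measurable_kernel:
  "case_prod (\<lambda>x y. N (inv y \<otimes> x)) \<in> borel_measurable (lebesgue \<Otimes>\<^sub>M lebesgue)"
proof -
  have "continuous_on UNIV (\<lambda>z. inv (snd z))"
    by (rule continuous_on_compose2[OF continuous_on_inv]) (auto intro!: continuous_on_snd continuous_on_id)
  then have "continuous_on UNIV (\<lambda>z. (\<lambda>(x, y). x \<otimes> y) (inv (snd z), fst z))"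
    by (intro continuous_on_compose2[OF continuous_on_mult] continuous_on_Pair continuous_on_fst continuous_on_id) auto
  then have "continuous_on UNIV (\<lambda>z. N (inv (snd z) \<otimes> fst z))"
    by (intro continuous_on_compose2[OF continuous_on_N[of UNIV]]) auto
  then have kernel: "(\<lambda>z. N (inv (snd z) \<otimes> fst z)) \<in> borel_measurable (borel \<Otimes>\<^sub>M borel)"
    unfolding borel_prod by (rule borel_measurable_continuous_onI)
  have "(\<lambda>z. z) \<in> measurable (lebesgue \<Otimes>\<^sub>M lebesgue) (borel \<Otimes>\<^sub>M borel)"
  proof -
    have id: "(\<lambda>x. x) \<in> measurable lebesgue borel"
      by (intro measurable_completion) simp
    have "(\<lambda>z. (fst z, snd z)) \<in> measurable (lebesgue \<Otimes>\<^sub>M lebesgue) (borel \<Otimes>\<^sub>M borel)"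
      by (intro measurable_Pair measurable_compose[OF measurable_fst id] measurable_compose[OF measurable_snd id])
    then show ?thesis by simp
  qed
  from measurable_compose[OF this kernel] show ?thesis
    by (simp only: case_prod_unfold)
qed

text \<open>Taking the root of order \<open>s\<close> in \<open>nn_integral_powr_le_weighted\<close>
  turns \<open>P powr s\<close> into \<open>P\<close>, so the bound is linear in the weighted
  integral. The constant precedes \<open>y\<close> and \<open>\<rho>\<close> because
  \<open>y\<close> is later integrated out and \<open>\<rho>\<close> optimised.\<close>

lemma Ls_norm_le_weighted:
  assumes s: "0 < s" "s < 1" and \<alpha>: "0 \<le> \<alpha>" and A: "A = Q * (1 / s - 1) - \<alpha>" "0 < A" "A < l"
  shows "\<exists>C>0. \<forall>f y \<rho>. in_Ls s f \<longrightarrow> (\<forall>x. 0 \<le> f x) \<longrightarrow> 0 < \<rho> \<longrightarrow>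
    ennreal (Ls_norm s f) \<le> ennreal C *
      (\<integral>\<^sup>+x. ennreal (f x * (\<rho> powr A * N x powr \<alpha> + \<rho> powr (A - l) * (N x powr \<alpha> * N (inv y \<otimes> x) powr l))) \<partial>lebesgue)"
proof -
  obtain M where M: "0 \<le> M"
    and ball: "\<And>y t. 0 < t \<Longrightarrow> emeasure lebesgue {x. N (inv y \<otimes> x) \<le> t} \<le> ennreal (M * t powr Q)"
    using measure_translated_N_ball by metis
  \<comment> \<open>The factor 2 arises because a sublevel set of \<open>m\<close> below is a union
    of two balls, one about the identity and one about \<open>y\<close>.\<close>
  define R where "R = 1 + (2 * M) * shell_const Q (\<alpha> * (s / (1 - s))) ((\<alpha> + l) * (s / (1 - s)))"
  have "\<alpha> * (s / (1 - s)) < Q" "Q < (\<alpha> + l) * (s / (1 - s))"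
    using s \<alpha> A(2,3) unfolding A(1) by (simp_all add: field_simps)
  then have "0 \<le> shell_const Q (\<alpha> * (s / (1 - s))) ((\<alpha> + l) * (s / (1 - s)))"
    by (intro less_imp_le shell_const_pos)
  then have R: "0 < R" using M by (simp add: R_def add_pos_nonneg)
  define C where "C = R powr (1 / s)"
  have C: "0 < C" using R by (simp add: C_def)
  have "ennreal (Ls_norm s f) \<le> ennreal C *
      (\<integral>\<^sup>+x. ennreal (f x * (\<rho> powr A * N x powr \<alpha> + \<rho> powr (A - l) * (N x powr \<alpha> * N (inv y \<otimes> x) powr l))) \<partial>lebesgue)"
    (is "_ \<le> _ * ?J")
    if f: "in_Ls s f" "\<forall>x. 0 \<le> f x" and \<rho>: "0 < \<rho>" for f y \<rho>
  proof (cases "?J = \<infinity>")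
    case True
    then show ?thesis using C by (simp add: ennreal_mult_top)
  next
    case False
    then obtain j where j: "0 \<le> j" "?J = ennreal j" by (cases ?J) auto
    \<comment> \<open>Minorising both weights by powers of \<open>m\<close> makes the bound uniform in \<open>y\<close>.\<close>
    define m where "m x = min (N x) (N (inv y \<otimes> x))" for x
    have m0: "0 \<le> m x" for x by (simp add: m_def)
    have mm: "m \<in> borel_measurable lebesgue"
      unfolding m_def by (intro measurable_completion) measurable
    have fm: "f \<in> borel_measurable lebesgue" and fi: "integrable lebesgue (\<lambda>x. f x powr s)"
      using f by (simp_all add: in_Ls_def)
    have growth: "emeasure lebesgue {x \<in> space lebesgue. m x \<le> t} \<le> ennreal (2 * M * t powr Q)" if t: "0 < t" for t
    proof -
      have sets: "{x. N (inv z \<otimes> x) \<le> t} \<in> sets lebesgue" for z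
      proof -
        have "{x \<in> space borel. N (inv z \<otimes> x) \<le> t} \<in> sets borel" by measurable
        then show ?thesis by simp
      qed
      have "{x \<in> space lebesgue. m x \<le> t} = {x. N (inv \<one> \<otimes> x) \<le> t} \<union> {x. N (inv y \<otimes> x) \<le> t}"
        by (auto simp: m_def)
      then have "emeasure lebesgue {x \<in> space lebesgue. m x \<le> t}
          \<le> emeasure lebesgue {x. N (inv \<one> \<otimes> x) \<le> t} + emeasure lebesgue {x. N (inv y \<otimes> x) \<le> t}"
        using emeasure_subadditive[OF sets[of \<one>] sets[of y]] by (simp only:)
      also have "\<dots> \<le> ennreal (M * t powr Q) + ennreal (M * t powr Q)"
        by (intro add_mono ball t)
      also have "\<dots> = ennreal (2 * M * t powr Q)"
        using M by (simp flip: ennreal_plus)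
      finally show ?thesis .
    qed
    \<comment> \<open>The weighted estimate divides by \<open>P\<close>, while the integral
      \<open>j\<close> may be 0; hence a positive \<open>P\<close> above \<open>j\<close>.\<close>
    have bound: "Ls_norm s f \<le> C * P" if P: "0 < P" "j \<le> P" for P
    proof -
      have "(\<integral>\<^sup>+x. ennreal (f x * (\<rho> powr A * m x powr \<alpha> + \<rho> powr (A - l) * m x powr (\<alpha> + l))) \<partial>lebesgue) \<le> ?J"
      proof (rule nn_integral_mono, rule ennreal_leI)
        fix x
        have "m x powr \<alpha> \<le> N x powr \<alpha>" "m x powr l \<le> N (inv y \<otimes> x) powr l"
          using \<alpha> A m0 by (auto simp: m_def intro!: powr_mono2)
        then have "m x powr (\<alpha> + l) \<le> N x powr \<alpha> * N (inv y \<otimes> x) powr l"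
          unfolding powr_add by (intro mult_mono) auto
        with \<open>m x powr \<alpha> \<le> N x powr \<alpha>\<close>
        show "f x * (\<rho> powr A * m x powr \<alpha> + \<rho> powr (A - l) * m x powr (\<alpha> + l))
          \<le> f x * (\<rho> powr A * N x powr \<alpha> + \<rho> powr (A - l) * (N x powr \<alpha> * N (inv y \<otimes> x) powr l))"
          using f(2) by (intro mult_left_mono add_mono) auto
      qed
      also have "\<dots> \<le> ennreal P" using P j by (simp add: ennreal_leI)
      finally have "(\<integral>\<^sup>+x. ennreal (f x powr s) \<partial>lebesgue) \<le> ennreal (P powr s * R)"
        unfolding R_def using mm fm m0 f(2) growth M hom_dim_pos s \<alpha> A \<rho> P
        by (intro nn_integral_powr_le_weighted[where m = m and \<rho> = \<rho> and A = A]) auto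
      then have "integral\<^sup>L lebesgue (\<lambda>x. f x powr s) \<le> P powr s * R"
        using R by (simp add: nn_integral_eq_integral[OF fi])
      then have "integral\<^sup>L lebesgue (\<lambda>x. f x powr s) powr (1 / s) \<le> (P powr s * R) powr (1 / s)"
        using s by (intro powr_mono2) auto
      also have "\<dots> = C * P" using P s R by (simp add: C_def powr_mult powr_powr)
      finally show ?thesis using f(2) by (simp add: Ls_norm_def)
    qed
    have "Ls_norm s f \<le> C * j + e" if "0 < e" for e
      using bound[of "j + e / C"] that j C by (simp add: distrib_left add_nonneg_pos)
    then have "Ls_norm s f \<le> C * j" by (rule field_le_epsilon)
    then show ?thesis using C j by (simp add: ennreal_leI flip: ennreal_mult)
  qed
  then show ?thesis using C by (intro exI[of _ C]) blast
qed

section \<open>The bilinear estimate for finite weighted masses\<close>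

lemma N_kernel_sym: "N (inv y \<otimes> x) = N (inv x \<otimes> y)"
  using N_inv[of "inv x \<otimes> y"] by (simp add: inv_mult_group)

text \<open>An instance of \<open>bilinear_form_ge\<close> in which the weights
  \<open>N x powr \<alpha>\<close> and \<open>N x powr \<beta>\<close> are absorbed into the
  functions. Because \<open>l = A + B\<close>, the exponents \<open>A - l\<close> and
  \<open>B - l\<close> of the one-sided estimates become \<open>- B\<close> and
  \<open>- A\<close>.\<close>

lemma bilinear_form_ge_of_finite:
  assumes s: "0 < s" "s < 1" and t: "0 < t" "t < 1" and \<alpha>\<beta>: "0 \<le> \<alpha>" "0 \<le> \<beta>"
    and A: "A = Q * (1 / s - 1) - \<alpha>" "0 < A" and B: "B = Q * (1 / t - 1) - \<beta>" "0 < B" and l: "l = A + B"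
  shows "\<exists>C>0. \<forall>f h. in_Ls s f \<longrightarrow> in_Ls t h \<longrightarrow> (\<forall>x. 0 \<le> f x) \<longrightarrow> (\<forall>x. 0 \<le> h x) \<longrightarrow>
    (\<integral>\<^sup>+x. ennreal (N x powr \<alpha> * f x) \<partial>lebesgue) < \<infinity> \<longrightarrow> (\<integral>\<^sup>+x. ennreal (N x powr \<beta> * h x) \<partial>lebesgue) < \<infinity> \<longrightarrow>
    ennreal (C * Ls_norm s f * Ls_norm t h) \<le>
    (\<integral>\<^sup>+y. (\<integral>\<^sup>+x. ennreal (N x powr \<alpha> * N (inv y \<otimes> x) powr l * f x * h y * N y powr \<beta>) \<partial>lebesgue) \<partial>lebesgue)"
proof -
  interpret lebesgue: sigma_finite_measure "lebesgue :: (real ^ 'a) measure"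
    by (rule sigma_finite_lebesgue)
  obtain C\<^sub>1 where C1: "0 < C\<^sub>1" and
    F: "\<forall>f y \<rho>. in_Ls s f \<longrightarrow> (\<forall>x. 0 \<le> f x) \<longrightarrow> 0 < \<rho> \<longrightarrow>
    ennreal (Ls_norm s f) \<le> ennreal C\<^sub>1 *
      (\<integral>\<^sup>+x. ennreal (f x * (\<rho> powr A * N x powr \<alpha> + \<rho> powr (A - l) * (N x powr \<alpha> * N (inv y \<otimes> x) powr l))) \<partial>lebesgue)"
    using Ls_norm_le_weighted[OF s \<alpha>\<beta>(1) A, of l] B l by auto
  obtain C\<^sub>2 where C2: "0 < C\<^sub>2" and
    H: "\<forall>f y \<rho>. in_Ls t f \<longrightarrow> (\<forall>x. 0 \<le> f x) \<longrightarrow> 0 < \<rho> \<longrightarrow>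
    ennreal (Ls_norm t f) \<le> ennreal C\<^sub>2 *
      (\<integral>\<^sup>+x. ennreal (f x * (\<rho> powr B * N x powr \<beta> + \<rho> powr (B - l) * (N x powr \<beta> * N (inv y \<otimes> x) powr l))) \<partial>lebesgue)"
    using Ls_norm_le_weighted[OF t \<alpha>\<beta>(2) B, of l] A l by auto
  define k where "k x y = ennreal (N (inv y \<otimes> x) powr l)" for x y
  have kc: "case_prod k \<in> borel_measurable (lebesgue \<Otimes>\<^sub>M lebesgue)"
  proof -
    have "(\<lambda>z. ennreal ((case z of (x, y) \<Rightarrow> N (inv y \<otimes> x)) powr l)) \<in> borel_measurable (lebesgue \<Otimes>\<^sub>M lebesgue)"
      using measurable_kernel by measurable
    then show ?thesis by (simp add: k_def case_prod_unfold)
  qed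
  have Nm: "N \<in> borel_measurable lebesgue"
    by (intro measurable_completion) simp
  have km: "(\<lambda>x. k x y) \<in> borel_measurable lebesgue" for y
    unfolding k_def by (intro measurable_completion) measurable
  \<comment> \<open>Brings the single integral of \<open>Ls_norm_le_weighted\<close> into the
    two-term form that \<open>bilinear_form_ge\<close> expects.\<close>
  have split: "ennreal c * (\<integral>\<^sup>+x. ennreal (f x * (a * N x powr \<gamma> + b * (N x powr \<gamma> * N (inv y \<otimes> x) powr l))) \<partial>lebesgue)
    = ennreal (c * a) * (\<integral>\<^sup>+x. ennreal (N x powr \<gamma> * f x) \<partial>lebesgue)
      + ennreal (c * b) * (\<integral>\<^sup>+x. k x y * ennreal (N x powr \<gamma> * f x) \<partial>lebesgue)"
    if [measurable]: "f \<in> borel_measurable lebesgue" and f: "\<And>x. 0 \<le> f x" and abc: "0 \<le> a" "0 \<le> b" "0 \<le> c"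
    for f and a b c \<gamma> :: real and y
  proof -
    note [measurable] = Nm km
    have "ennreal (f x * (a * N x powr \<gamma> + b * (N x powr \<gamma> * N (inv y \<otimes> x) powr l)))
      = ennreal a * ennreal (N x powr \<gamma> * f x) + ennreal b * (k x y * ennreal (N x powr \<gamma> * f x))" for x
    proof -
      have "f x * (a * N x powr \<gamma> + b * (N x powr \<gamma> * N (inv y \<otimes> x) powr l))
        = a * (N x powr \<gamma> * f x) + b * (N (inv y \<otimes> x) powr l * (N x powr \<gamma> * f x))"
        by (simp add: algebra_simps)
      then show ?thesis using f[of x] abc by (simp add: k_def flip: ennreal_mult ennreal_plus)
    qed
    then have "(\<integral>\<^sup>+x. ennreal (f x * (a * N x powr \<gamma> + b * (N x powr \<gamma> * N (inv y \<otimes> x) powr l))) \<partial>lebesgue)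
      = ennreal a * (\<integral>\<^sup>+x. ennreal (N x powr \<gamma> * f x) \<partial>lebesgue)
      + ennreal b * (\<integral>\<^sup>+x. k x y * ennreal (N x powr \<gamma> * f x) \<partial>lebesgue)"
      by (simp add: nn_integral_add nn_integral_cmult)
    then show ?thesis using abc by (simp add: distrib_left ennreal_mult mult.assoc)
  qed
  define C where "C = 1 / (4 * C\<^sub>1 * C\<^sub>2)"
  have C: "0 < C" using C1 C2 by (simp add: C_def)
  have "ennreal (C * Ls_norm s f * Ls_norm t h) \<le>
    (\<integral>\<^sup>+y. (\<integral>\<^sup>+x. ennreal (N x powr \<alpha> * N (inv y \<otimes> x) powr l * f x * h y * N y powr \<beta>) \<partial>lebesgue) \<partial>lebesgue)"
    (is "_ \<le> ?I")
    if f: "in_Ls s f" "\<forall>x. 0 \<le> f x" and h: "in_Ls t h" "\<forall>x. 0 \<le> h x"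
      and fin: "(\<integral>\<^sup>+x. ennreal (N x powr \<alpha> * f x) \<partial>lebesgue) < \<infinity>" "(\<integral>\<^sup>+x. ennreal (N x powr \<beta> * h x) \<partial>lebesgue) < \<infinity>"
    for f h
  proof -
    have fm: "f \<in> borel_measurable lebesgue" and hm: "h \<in> borel_measurable lebesgue"
      using f(1) h(1) by (simp_all add: in_Ls_def)
    have nonneg: "0 \<le> Ls_norm s f" "0 \<le> Ls_norm t h" by (simp_all add: Ls_norm_def)
    have "ennreal (Ls_norm s f * Ls_norm t h) \<le> ennreal (4 * C\<^sub>1 * C\<^sub>2) *
      (\<integral>\<^sup>+y. (\<integral>\<^sup>+x. k x y * ennreal (N x powr \<alpha> * f x) * ennreal (N y powr \<beta> * h y) \<partial>lebesgue) \<partial>lebesgue)"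
    proof (rule lebesgue.bilinear_form_ge[OF _ _ kc _ C1 C2 nonneg A(2) B(2)])
      show "(\<lambda>x. ennreal (N x powr \<alpha> * f x)) \<in> borel_measurable lebesgue"
        using Nm fm by measurable
      show "(\<lambda>x. ennreal (N x powr \<beta> * h x)) \<in> borel_measurable lebesgue"
        using Nm hm by measurable
      show "k x y = k y x" for x y by (simp add: k_def N_kernel_sym)
      fix y and \<rho> :: real assume \<rho>: "0 < \<rho>"
      have l': "A - l = - B" "B - l = - A" using l by simp_all
      show "ennreal (Ls_norm s f) \<le> ennreal (C\<^sub>1 * \<rho> powr A) * (\<integral>\<^sup>+x. ennreal (N x powr \<alpha> * f x) \<partial>lebesgue)
        + ennreal (C\<^sub>1 * \<rho> powr (- B)) * (\<integral>\<^sup>+x. k x y * ennreal (N x powr \<alpha> * f x) \<partial>lebesgue)"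
        using F[rule_format, OF f(1) _ \<rho>, of y] f(2) C1 by (subst split[symmetric]) (auto simp: fm l'(1))
      show "ennreal (Ls_norm t h) \<le> ennreal (C\<^sub>2 * \<rho> powr B) * (\<integral>\<^sup>+x. ennreal (N x powr \<beta> * h x) \<partial>lebesgue)
        + ennreal (C\<^sub>2 * \<rho> powr (- A)) * (\<integral>\<^sup>+x. k x y * ennreal (N x powr \<beta> * h x) \<partial>lebesgue)"
        using H[rule_format, OF h(1) _ \<rho>, of y] h(2) C2 by (subst split[symmetric]) (auto simp: hm l'(2))
    qed (use fin in auto)
    also have "(\<integral>\<^sup>+y. (\<integral>\<^sup>+x. k x y * ennreal (N x powr \<alpha> * f x) * ennreal (N y powr \<beta> * h y) \<partial>lebesgue) \<partial>lebesgue) = ?I"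
      using f(2) h(2) by (simp add: k_def mult_ac flip: ennreal_mult)
    finally have "ennreal C * ennreal (Ls_norm s f * Ls_norm t h) \<le> ennreal C * (ennreal (4 * C\<^sub>1 * C\<^sub>2) * ?I)"
      by (rule mult_left_mono) simp
    also have "\<dots> = ennreal (C * (4 * C\<^sub>1 * C\<^sub>2)) * ?I"
      using C C1 C2 by (simp add: ennreal_mult mult.assoc)
    also have "C * (4 * C\<^sub>1 * C\<^sub>2) = 1" using C1 C2 by (simp add: C_def)
    finally show ?thesis using C nonneg by (simp add: mult.assoc flip: ennreal_mult)
  qed
  then show ?thesis using C by (intro exI[of _ C]) blast
qed

section \<open>Truncation and removal of the finiteness conditions\<close>

text \<open>Cutting both height and support leaves a function bounded above that vanishes off a
  compact ball; for a non-negative \<open>f\<close> its weighted mass is finite.\<close>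

definition truncation :: "nat \<Rightarrow> (real ^ 'a \<Rightarrow> real) \<Rightarrow> real ^ 'a \<Rightarrow> real" where
  "truncation n f x = (if N x \<le> real n then min (f x) (real n) else 0)"

lemma truncation_nonneg: "(\<And>x. 0 \<le> f x) \<Longrightarrow> 0 \<le> truncation n f x"
  and truncation_le: "(\<And>x. 0 \<le> f x) \<Longrightarrow> truncation n f x \<le> f x"
  by (auto simp: truncation_def)

lemma measurable_truncation:
  assumes "f \<in> borel_measurable lebesgue"
  shows "truncation n f \<in> borel_measurable lebesgue"
proof -
  have [measurable]: "N \<in> borel_measurable lebesgue"
    by (intro measurable_completion) simp
  show ?thesis unfolding truncation_def[abs_def] using assms by measurable
qed

lemma in_Ls_truncation:
  assumes f: "in_Ls s f" "\<And>x. 0 \<le> f x" and s: "0 < s"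
  shows "in_Ls s (truncation n f)"
proof -
  have m: "truncation n f \<in> borel_measurable lebesgue"
    using f(1) by (intro measurable_truncation) (simp add: in_Ls_def)
  have "integrable lebesgue (\<lambda>x. \<bar>truncation n f x\<bar> powr s)"
  proof (rule Bochner_Integration.integrable_bound)
    show "integrable lebesgue (\<lambda>x. \<bar>f x\<bar> powr s)" using f(1) by (simp add: in_Ls_def)
    show "(\<lambda>x. \<bar>truncation n f x\<bar> powr s) \<in> borel_measurable lebesgue" using m by measurable
    have "\<bar>truncation n f x\<bar> powr s \<le> \<bar>f x\<bar> powr s" for x
      using truncation_nonneg[of f n x] truncation_le[of f n x] f(2) s by (intro powr_mono2) auto
    then show "AE x in lebesgue. norm (\<bar>truncation n f x\<bar> powr s) \<le> norm (\<bar>f x\<bar> powr s)" by simp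
  qed
  with m show ?thesis by (simp add: in_Ls_def)
qed

lemma nn_integral_truncation_finite:
  assumes "\<And>x. 0 \<le> f x" "0 \<le> \<gamma>"
  shows "(\<integral>\<^sup>+x. ennreal (N x powr \<gamma> * truncation n f x) \<partial>lebesgue) < \<infinity>"
proof -
  \<comment> \<open>The radius is \<open>n + 1\<close> because \<open>compact_N_ball\<close> asks
    for a positive radius and \<open>n\<close> may be 0.\<close>
  define S where "S = {x. N x \<le> real n + 1}"
  have S: "S \<in> lmeasurable" unfolding S_def by (intro lmeasurable_compact compact_N_ball) simp
  have "N x powr \<gamma> * truncation n f x \<le> real n powr \<gamma> * real n" if "N x \<le> real n" for x
    using that assms by (intro mult_mono powr_mono2) (auto simp: truncation_def)
  then have "ennreal (N x powr \<gamma> * truncation n f x) \<le> ennreal (real n powr \<gamma> * real n) * indicator S x" for x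
    by (cases "N x \<le> real n") (auto simp: truncation_def S_def intro!: ennreal_leI)
  then have "(\<integral>\<^sup>+x. ennreal (N x powr \<gamma> * truncation n f x) \<partial>lebesgue)
      \<le> (\<integral>\<^sup>+x. ennreal (real n powr \<gamma> * real n) * indicator S x \<partial>lebesgue)"
    by (intro nn_integral_mono) simp
  also have "\<dots> = ennreal (real n powr \<gamma> * real n) * emeasure lebesgue S"
    using S by (intro nn_integral_cmult_indicator) (rule fmeasurableD)
  also have "\<dots> < \<infinity>"
    using S by (simp add: emeasure_eq_measure2 ennreal_mult_less_top)
  finally show ?thesis .
qed

text \<open>Dominated convergence with majorant \<open>\<bar>f x\<bar> powr s\<close>; at each point
  the truncations are eventually equal to \<open>f\<close>.\<close>

lemma Ls_norm_truncation_tendsto: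
  assumes f: "in_Ls s f" "\<And>x. 0 \<le> f x" and s: "0 < s"
  shows "(\<lambda>n. Ls_norm s (truncation n f)) \<longlonglongrightarrow> Ls_norm s f"
proof -
  have "(\<lambda>n. \<integral>x. \<bar>truncation n f x\<bar> powr s \<partial>lebesgue) \<longlonglongrightarrow> (\<integral>x. \<bar>f x\<bar> powr s \<partial>lebesgue)"
  proof (rule integral_dominated_convergence)
    show "(\<lambda>x. \<bar>f x\<bar> powr s) \<in> borel_measurable lebesgue" "integrable lebesgue (\<lambda>x. \<bar>f x\<bar> powr s)"
      using f(1) by (auto simp: in_Ls_def)
    show "(\<lambda>x. \<bar>truncation n f x\<bar> powr s) \<in> borel_measurable lebesgue" for n
      using in_Ls_truncation[OF f s, of n] by (auto simp: in_Ls_def)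
    have "(\<lambda>n. \<bar>truncation n f x\<bar> powr s) \<longlonglongrightarrow> \<bar>f x\<bar> powr s" for x
    proof (rule tendsto_eventually)
      obtain n\<^sub>0 :: nat where "max (f x) (N x) \<le> real n\<^sub>0" using real_arch_simple by (rule exE)
      then have "truncation n f x = f x" if "n\<^sub>0 \<le> n" for n
        using that by (auto simp: truncation_def min_def)
      then show "\<forall>\<^sub>F n in sequentially. \<bar>truncation n f x\<bar> powr s = \<bar>f x\<bar> powr s"
        unfolding eventually_sequentially by (intro exI[of _ n\<^sub>0]) simp
    qed
    then show "AE x in lebesgue. (\<lambda>n. \<bar>truncation n f x\<bar> powr s) \<longlonglongrightarrow> \<bar>f x\<bar> powr s" by simp
    have "\<bar>truncation n f x\<bar> powr s \<le> \<bar>f x\<bar> powr s" for n x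
      using truncation_nonneg[of f n x] truncation_le[of f n x] f(2) s by (intro powr_mono2) auto
    then show "AE x in lebesgue. norm (\<bar>truncation n f x\<bar> powr s) \<le> \<bar>f x\<bar> powr s" for n by simp
  qed
  \<comment> \<open>The limit of the integrals may be 0; the root is still continuous there, since
    \<open>1 / s\<close> is positive and the integrals are non-negative.\<close>
  then show ?thesis unfolding Ls_norm_def using s
    by (intro tendsto_powr') (auto intro!: always_eventually)
qed

text \<open>Truncations satisfy the finite-mass estimate, and their double integral is at most the
  one of \<open>f\<close> and \<open>h\<close>. Convergence of their norms then passes the bound to
  the limit.\<close>

lemma reverse_Stein_Weiss:
  assumes s: "0 < s" "s < 1" and t: "0 < t" "t < 1"
    and \<alpha>: "0 \<le> \<alpha>" "\<alpha> < Q * (1 / s - 1)" and \<beta>: "0 \<le> \<beta>" "\<beta> < Q * (1 / t - 1)"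
    and l: "\<alpha> + \<beta> + l = Q * (1 / s - 1) + Q * (1 / t - 1)"
  shows "\<exists>C>0. \<forall>f h. in_Ls s f \<longrightarrow> in_Ls t h \<longrightarrow> (\<forall>x. 0 \<le> f x) \<longrightarrow> (\<forall>x. 0 \<le> h x) \<longrightarrow>
    ennreal (C * Ls_norm s f * Ls_norm t h) \<le>
    (\<integral>\<^sup>+y. (\<integral>\<^sup>+x. ennreal (N x powr \<alpha> * N (inv y \<otimes> x) powr l * f x * h y * N y powr \<beta>) \<partial>lebesgue) \<partial>lebesgue)"
proof -
  obtain C where C: "0 < C" and
    fin: "\<forall>f h. in_Ls s f \<longrightarrow> in_Ls t h \<longrightarrow> (\<forall>x. 0 \<le> f x) \<longrightarrow> (\<forall>x. 0 \<le> h x) \<longrightarrow>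
    (\<integral>\<^sup>+x. ennreal (N x powr \<alpha> * f x) \<partial>lebesgue) < \<infinity> \<longrightarrow> (\<integral>\<^sup>+x. ennreal (N x powr \<beta> * h x) \<partial>lebesgue) < \<infinity> \<longrightarrow>
    ennreal (C * Ls_norm s f * Ls_norm t h) \<le>
    (\<integral>\<^sup>+y. (\<integral>\<^sup>+x. ennreal (N x powr \<alpha> * N (inv y \<otimes> x) powr l * f x * h y * N y powr \<beta>) \<partial>lebesgue) \<partial>lebesgue)"
    using bilinear_form_ge_of_finite[OF s t \<alpha>(1) \<beta>(1) refl _ refl, of l] \<alpha> \<beta> l by auto
  have "ennreal (C * Ls_norm s f * Ls_norm t h) \<le>
    (\<integral>\<^sup>+y. (\<integral>\<^sup>+x. ennreal (N x powr \<alpha> * N (inv y \<otimes> x) powr l * f x * h y * N y powr \<beta>) \<partial>lebesgue) \<partial>lebesgue)"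
    (is "_ \<le> ?I f h")
    if f: "in_Ls s f" "\<forall>x. 0 \<le> f x" and h: "in_Ls t h" "\<forall>x. 0 \<le> h x" for f h
  proof (cases "?I f h = \<infinity>")
    case False
    then obtain i where i: "0 \<le> i" "?I f h = ennreal i" by (cases "?I f h") auto
    define f' h' where "f' n = truncation n f" and "h' n = truncation n h" for n
    note tr = truncation_nonneg truncation_le in_Ls_truncation nn_integral_truncation_finite
    have "C * Ls_norm s (f' n) * Ls_norm t (h' n) \<le> i" for n
    proof -
      have "ennreal (C * Ls_norm s (f' n) * Ls_norm t (h' n)) \<le> ?I (f' n) (h' n)"
        unfolding f'_def h'_def using f h s t \<alpha> \<beta> by (intro fin[rule_format] tr) auto
      also have "\<dots> \<le> ?I f h"
      proof (intro nn_integral_mono ennreal_leI)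
        fix x y
        have "f' n x * h' n y \<le> f x * h y"
          unfolding f'_def h'_def using f h by (intro mult_mono tr) auto
        then have "(N x powr \<alpha> * N (inv y \<otimes> x) powr l * N y powr \<beta>) * (f' n x * h' n y)
          \<le> (N x powr \<alpha> * N (inv y \<otimes> x) powr l * N y powr \<beta>) * (f x * h y)"
          by (intro mult_left_mono) auto
        then show "N x powr \<alpha> * N (inv y \<otimes> x) powr l * f' n x * h' n y * N y powr \<beta>
          \<le> N x powr \<alpha> * N (inv y \<otimes> x) powr l * f x * h y * N y powr \<beta>"
          by (simp only: mult_ac)
      qed
      finally show ?thesis using i by simp
    qed
    moreover have "(\<lambda>n. C * Ls_norm s (f' n) * Ls_norm t (h' n)) \<longlonglongrightarrow> C * Ls_norm s f * Ls_norm t h"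
      unfolding f'_def h'_def using f h s t by (intro tendsto_mult tendsto_const Ls_norm_truncation_tendsto) auto
    ultimately have "C * Ls_norm s f * Ls_norm t h \<le> i"
      by (intro LIMSEQ_le_const2) auto
    then show ?thesis using i by (simp add: ennreal_leI)
  qed simp
  then show ?thesis using C by (intro exI[of _ C]) blast
qed

end

theorem theorem2p5:
  fixes G :: "(real ^ 'n::finite) monoid"
    and \<nu> :: "'n \<Rightarrow> real"
    and N :: "real ^ 'n \<Rightarrow> real"
    and Q l p p' q q' \<alpha> \<beta> :: real
  assumes "homogeneous_group G \<nu>"
    and "Q = hom_dim \<nu>" and "Q \<ge> 1"
    and "homogeneous_quasi_norm G \<nu> N"
    and "l > 0"
    and "0 < p" and "p < 1"
    and "0 < q'" and "q' < 1"
    and "1 / p + 1 / p' = 1"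
    and "1 / q + 1 / q' = 1"
    and "0 \<le> \<alpha>" and "\<alpha> < - (Q / q)"
    and "0 \<le> \<beta>" and "\<beta> < - (Q / p')"
    and "1 / q' + 1 / p = (\<alpha> + \<beta> + l) / Q + 2"
  shows "\<exists>C>0. \<forall>f h. in_Ls q' f \<longrightarrow> in_Ls p h \<longrightarrow> (\<forall>x. f x \<ge> 0) \<longrightarrow> (\<forall>x. h x \<ge> 0) \<longrightarrow>
    (\<integral>\<^sup>+ y. (\<integral>\<^sup>+ x. ennreal (N x powr \<alpha> * N (inv\<^bsub>G\<^esub> y \<otimes>\<^bsub>G\<^esub> x) powr l * f x * h y * N y powr \<beta>)
        \<partial>lebesgue) \<partial>lebesgue)
      \<ge> ennreal (C * Ls_norm q' f * Ls_norm p h)"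
proof -
  interpret homogeneous_group G \<nu> by (rule assms(1))
  interpret homogeneous_quasi_normed_group G \<nu> N by unfold_locales (rule assms(4))
  \<comment> \<open>Conjugacy rewrites the bounds on \<open>\<alpha>\<close> and
    \<open>\<beta>\<close> in terms of \<open>q'\<close> and \<open>p\<close>, which become
    \<open>s\<close> and \<open>t\<close>. The convention \<open>1 / 0 = 0\<close> does no harm:
    \<open>q = 0\<close> would force \<open>q' = 1\<close>, and \<open>p' = 0\<close> would force
    \<open>p = 1\<close>.\<close>
  have "1 / q' - 1 = - (1 / q)" "1 / p - 1 = - (1 / p')"
    using assms(10,11) by linarith+
  then have conj: "- (Q / q) = Q * (1 / q' - 1)" "- (Q / p') = Q * (1 / p - 1)"
    by simp_all
  have "(\<alpha> + \<beta> + l) / Q = (1 / q' - 1) + (1 / p - 1)"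
    using assms(16) by linarith
  then have "\<alpha> + \<beta> + l = Q * ((1 / q' - 1) + (1 / p - 1))"
    using assms(3) by (simp add: divide_eq_eq mult.commute)
  then have l: "\<alpha> + \<beta> + l = hom_dim \<nu> * (1 / q' - 1) + hom_dim \<nu> * (1 / p - 1)"
    unfolding assms(2) by (simp only: distrib_left)
  have \<alpha>: "\<alpha> < hom_dim \<nu> * (1 / q' - 1)" and \<beta>: "\<beta> < hom_dim \<nu> * (1 / p - 1)"
    using assms(13,15) unfolding conj unfolding assms(2) .
  show ?thesis
    by (rule reverse_Stein_Weiss[OF assms(8,9,6,7,12) \<alpha> assms(14) \<beta> l])
qed

end
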